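(* Suppose $f$ satisfies assumptions (1)–(4) of the context. Then there exist constants $C=C(d,\alpha,f,K)>0$ and $C'=C'(d,\alpha,f,K)>0$ such that for all integers $n\ge1$ and all $x\in\Lambda_L$, $$\Bigl|p_n(0,x)-\frac1N\Bigr|\le C\,W^{-d}n^{-d/\alpha}+C'\,nW^{-K}.$$ In addition, if $nW^{-K}\ll N^{-1}$, then $p_n(0,x)\le C\bigl(W^{-d}n^{-d/\alpha}+N^{-1}\bigr)$.
   Context: $\Lambda_L=(\mathbb Z/L\mathbb Z)^d$ and $N=L^d$; $W>0$. For $f:\mathbb R^d\to\mathbb R$ define $$\sigma^2_{xy}=\frac1M\sum_{m\in\mathbb Z^d}f\Bigl(\frac{x-y+mL}{W}\Bigr),\qquad M=\sum_{m\in\mathbb Z^d}f(m/W),$$ and let $p_n(x,y)$ be the $n$-step transition probabilities of the Markov chain on $\Lambda_L$ with transition matrix $(\sigma_{xy}^2)$. Let $\hat f(\xi)=\int_{\mathbb R^d}f(u)e^{-2\pi i\xi\cdot u}du$. Assume there are constants $\alpha\in(0,2]$, $c_0>0$, $\varepsilon>0$ and $0<\rho<1$ with: 1. $f\ge0$ and $\int f=1$; 2. $|\hat f(\xi)|\le\exp(-c_0|\xi|^\alpha)$ for $|\xi|\le\varepsilon$; 3. $|\hat f(\xi)|\le\rho$ for $|\xi|>\varepsilon$; 4. $f$ is continuous, and for constants $T,K>d$ and $C_T,C_K>1$, $f(x)\le C_T(1+|x|)^{-T}$ and $|\hat f(\xi)|\le C_K(1+|\xi|)^{-K}$. *)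

theory Defs
  imports "HOL-Analysis.Analysis"
begin

text \<open>The torus (Z/LZ)^d, represented by the canonical representatives
  with coordinates in 0..L-1; the dimension d is CARD('d).\<close>
definition lattice_box :: "nat \<Rightarrow> (int^'d) set" where
  "lattice_box L = {x. \<forall>i. 0 \<le> x$i \<and> x$i < int L}"

definition rvec :: "int^'d \<Rightarrow> real^'d" where
  "rvec v = (\<chi> i. real_of_int (v$i))"

definition band_norm :: "(real^'d \<Rightarrow> real) \<Rightarrow> real \<Rightarrow> real" where
  "band_norm f W = infsum (\<lambda>m::int^'d. f (rvec m /\<^sub>R W)) UNIV"

definition sigma2 :: "(real^'d \<Rightarrow> real) \<Rightarrow> real \<Rightarrow> nat \<Rightarrow> int^'d \<Rightarrow> int^'d \<Rightarrow> real" where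
  "sigma2 f W L x y =
     infsum (\<lambda>m::int^'d. f (rvec (x - y + (\<chi> i. int L * m$i)) /\<^sub>R W)) UNIV / band_norm f W"

fun trans_prob :: "(real^'d \<Rightarrow> real) \<Rightarrow> real \<Rightarrow> nat \<Rightarrow> nat \<Rightarrow> int^'d \<Rightarrow> int^'d \<Rightarrow> real" where
  "trans_prob f W L 0 x y = (if x = y then 1 else 0)"
| "trans_prob f W L (Suc n) x y = (\<Sum>z\<in>lattice_box L. trans_prob f W L n x z * sigma2 f W L z y)"

definition fourier :: "(real^'d \<Rightarrow> real) \<Rightarrow> real^'d \<Rightarrow> complex" where
  "fourier f \<xi> = integral UNIV (\<lambda>u. complex_of_real (f u) * cis (- 2 * pi * (\<xi> \<bullet> u)))"

end

(*
  Poisson summation turns the symbol of the transition matrix at a frequency k into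
  (sum over m of fhat (W (m + k/L))) / (sum over m of fhat (W m)), which equals
  fhat (W k/L) up to O(W^-K), provided k/L is represented in the cube [-1/2,1/2]^d.
  Since symbol and fhat are bounded by 1, their n-th powers differ by O(n W^-K).
  Fourier inversion on the torus bounds the deviation of p_n from 1/N by the average of the
  n-th powers over k ~= 0, and the average of |fhat (W k/L)|^n over k ~= 0 is a Riemann-type
  sum of order W^-d n^(-d/alpha). For W below a fixed constant the second error term
  exceeds 1 and the bound is trivial.
*)
theory Submission
  imports Defs
begin

text \<open>The bound has to be uniform in \<open>L\<close>, \<open>W\<close> and \<open>n\<close>,
  so the mesh W/L of the Riemann-type sum may be arbitrarily fine or coarse. Each frequency sum is
  therefore compared with sums of \<open>(1 + a * norm (rvec k)) powr (- K)\<close> over lattice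
  points other than the origin, which are at most a constant times a^-d for every a > 0. Low
  frequencies fit this form because the n in the exponent can be absorbed into the scale a. At high
  frequencies a geometric factor in n alone would not be summable over the lattice, so one factor of
  fhat is kept for its K-decay. Poisson summation is itself derived here, from the fact that a
  continuous function on the cube whose Fourier coefficients all vanish is zero at the origin. The
  fixed constant for W is the point beyond which the sum of fhat (W m) has modulus at least 1/2.
  This makes the quotient stable and the normalization positive; for small W a continuous profile
  can vanish at every lattice point.\<close>

section \<open>Lattice sums of decaying powers\<close>

text \<open>Vectors indexed by \<open>'d\<close> are the functions in \<open>PiE UNIV J\<close>, so
  this is the distributive law. It reduces d-dimensional sums to one coordinate, both for decay
  weights and for roots of unity.\<close>

lemma sum_vec_box_prod:
  fixes g :: "'d::finite \<Rightarrow> int \<Rightarrow> 'c::comm_semiring_1"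
  assumes "\<And>i. finite (J i)"
  shows "(\<Sum>k\<in>{k::int^'d. \<forall>i. k$i \<in> J i}. \<Prod>i\<in>UNIV. g i (k$i)) = (\<Prod>i\<in>UNIV. \<Sum>j\<in>J i. g i j)"
proof -
  have "(\<Prod>i\<in>UNIV. \<Sum>j\<in>J i. g i j) = (\<Sum>p\<in>PiE UNIV J. \<Prod>i\<in>UNIV. g i (p i))"
    by (rule prod_sum_PiE) (use assms in auto)
  also have "\<dots> = (\<Sum>k\<in>{k::int^'d. \<forall>i. k$i \<in> J i}. \<Prod>i\<in>UNIV. g i (k$i))"
    by (rule sum.reindex_bij_witness[where i = vec_nth and j = vec_lambda]) (auto simp: PiE_def)
  finally show ?thesis by simp
qed

lemma finite_vec_box:
  assumes "\<And>i. finite (J i)"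
  shows "finite {k::int^'d. \<forall>i. k$i \<in> J i}"
proof -
  have "{k::int^'d. \<forall>i. k$i \<in> J i} = vec_lambda ` PiE UNIV J"
    by (auto simp: image_iff PiE_def intro!: bexI[of _ "vec_nth _"])
  then show ?thesis using assms by (simp add: finite_PiE)
qed

text \<open>Comparison with the integral of \<open>(1 + a * t) powr (- s)\<close>; the dependence of
  the bound on \<open>a\<close> has to stay explicit.\<close>

lemma sum_shifted_powr_le:
  fixes a s :: real
  assumes a: "a > 0" and s: "s > 1"
  shows "(\<Sum>j=1..R. (1 + a * real j) powr (- s)) \<le> 1 / (a * (s - 1))"
proof -
  \<comment> \<open>The right-hand side is the integral from 0 to \<open>R\<close>. It telescopes,
    and the mean value theorem compares its increment with one summand.\<close>
  have "(\<Sum>j=1..R. (1 + a * real j) powr (- s)) \<le> (1 - (1 + a * real R) powr (1 - s)) / (a * (s - 1))"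
  proof (induction R)
    case (Suc R)
    define x y where "x = 1 + a * real R" and "y = 1 + a * real (Suc R)"
    have xy: "0 < x" "x < y" using a by (auto simp: x_def y_def add_pos_nonneg)
    have "\<exists>z. x < z \<and> z < y \<and> y powr (1 - s) - x powr (1 - s) = (y - x) * ((1 - s) * z powr (1 - s - 1))"
      using xy by (intro MVT2 has_real_derivative_powr) auto
    then obtain z where z: "x < z" "z < y"
      "y powr (1 - s) - x powr (1 - s) = (y - x) * ((1 - s) * z powr (- s))" by auto
    have "y powr (- s) \<le> z powr (- s)" using z xy s by (intro powr_mono2') auto
    then have "a * (s - 1) * y powr (- s) \<le> a * (s - 1) * z powr (- s)"
      using a s by (intro mult_left_mono) auto
    also have "\<dots> = x powr (1 - s) - y powr (1 - s)"
      using z(3) by (simp add: x_def y_def algebra_simps)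
    finally have "y powr (- s) \<le> (x powr (1 - s) - y powr (1 - s)) / (a * (s - 1))"
      using a s by (simp add: field_simps)
    with Suc.IH show ?case
      unfolding y_def x_def by (simp add: diff_divide_distrib)
  qed simp
  also have "\<dots> \<le> 1 / (a * (s - 1))" using a s by (intro divide_right_mono) auto
  finally show ?thesis .
qed

lemma sum_int_shifted_powr_le:
  fixes a s :: real
  assumes a: "a > 0" and s: "s > 1"
  shows "(\<Sum>j\<in>{- int R..int R}. (1 + a * \<bar>real_of_int j\<bar>) powr (- s)) \<le> 1 + 2 / (a * (s - 1))"
proof -
  let ?h = "\<lambda>j::int. (1 + a * \<bar>real_of_int j\<bar>) powr (- s)"
  have pos: "sum ?h {1..int R} = (\<Sum>j=1..R. (1 + a * real j) powr (- s))"
    by (rule sum.reindex_bij_witness[where i = int and j = nat]) auto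
  have neg: "sum ?h {- int R..-1} = sum ?h {1..int R}"
    by (rule sum.reindex_bij_witness[where i = uminus and j = uminus]) auto
  have "{- int R..int R} = {- int R..-1} \<union> {0} \<union> {1..int R}" by auto
  then have "sum ?h {- int R..int R} = sum ?h {- int R..-1} + 1 + sum ?h {1..int R}"
    by (simp add: sum.union_disjoint)
  then show ?thesis using neg pos sum_shifted_powr_le[OF a s, of R] by (simp add: field_simps)
qed

lemma rvec_nth [simp]: "rvec v $ i = real_of_int (v $ i)"
  by (simp add: rvec_def)

lemma rvec_0 [simp]: "rvec 0 = 0"
  by (simp add: vec_eq_iff)

lemma rvec_eq_0_iff [simp]: "rvec v = 0 \<longleftrightarrow> v = 0"
  by (simp add: vec_eq_iff)

lemma rvec_add: "rvec (v + w) = rvec v + rvec w"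
  by (simp add: vec_eq_iff)

lemma rvec_diff: "rvec (v - w) = rvec v - rvec w"
  by (simp add: vec_eq_iff)

lemma norm_rvec_ge_1: "v \<noteq> 0 \<Longrightarrow> norm (rvec v) \<ge> 1"
proof -
  assume "v \<noteq> 0"
  then obtain i where "v $ i \<noteq> 0" by (auto simp: vec_eq_iff)
  then have "1 \<le> \<bar>rvec v $ i\<bar>" by simp
  then show ?thesis using component_le_norm_cart[of "rvec v" i] by linarith
qed

text \<open>The norm dominates each coordinate, so the summand is at most a product over the d
  coordinates with exponent K / d in each. The hypothesis K > d says precisely that this exponent
  exceeds 1.\<close>

lemma sum_lattice_powr_le_power:
  fixes a K :: real and A :: "(int^'d) set"
  assumes a: "a > 0" and K: "K > real CARD('d)" and A: "finite A"
  shows "(\<Sum>k\<in>A. (1 + a * norm (rvec k)) powr (- K))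
           \<le> (1 + 2 / (a * (K / real CARD('d) - 1))) ^ CARD('d)"
proof -
  define s where "s = K / real CARD('d)"
  have s: "s > 1" using K by (simp add: s_def)
  \<comment> \<open>Any box containing \<open>A\<close> will do, because the one-dimensional bound
    does not depend on \<open>R\<close>. Inserting 0 covers empty \<open>A\<close>.\<close>
  define R where "R = Max (insert 0 ((\<lambda>(k,i). nat \<bar>k$i\<bar>) ` (A \<times> UNIV)))"
  define B where "B = {k::int^'d. \<forall>i. k$i \<in> {- int R..int R}}"
  have finB: "finite B" unfolding B_def by (rule finite_vec_box) simp
  have "A \<subseteq> B"
  proof
    fix k assume k: "k \<in> A"
    have R: "nat \<bar>k$i\<bar> \<le> R" for i
      unfolding R_def by (rule Max_ge) (use A k in \<open>auto intro!: image_eqI[of _ _ "(k,i)"]\<close>)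
    have "- int R \<le> k$i \<and> k$i \<le> int R" for i using R[of i] by linarith
    then show "k \<in> B" by (simp add: B_def)
  qed
  have factor: "(1 + a * norm (rvec k)) powr (- K)
      \<le> (\<Prod>i\<in>(UNIV::'d set). (1 + a * \<bar>real_of_int (k$i)\<bar>) powr (- s))" for k :: "int^'d"
  proof -
    have "1 + a * norm (rvec k) > 0" using a by (simp add: add_pos_nonneg)
    then have "(1 + a * norm (rvec k)) powr (- K) = (\<Prod>i\<in>(UNIV::'d set). (1 + a * norm (rvec k)) powr (- s))"
      by (simp add: powr_power s_def)
    also have "\<dots> \<le> (\<Prod>i\<in>(UNIV::'d set). (1 + a * \<bar>real_of_int (k$i)\<bar>) powr (- s))"
    proof (intro prod_mono conjI powr_mono2')
      fix i show "1 + a * \<bar>real_of_int (k$i)\<bar> \<le> 1 + a * norm (rvec k)"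
        using component_le_norm_cart[of "rvec k" i] a by simp
    qed (use a s in \<open>auto simp: add_pos_nonneg\<close>)
    finally show ?thesis .
  qed
  have "(\<Sum>k\<in>A. (1 + a * norm (rvec k)) powr (- K)) \<le> (\<Sum>k\<in>B. (1 + a * norm (rvec k)) powr (- K))"
    using \<open>A \<subseteq> B\<close> finB by (intro sum_mono2) auto
  also have "\<dots> \<le> (\<Sum>k\<in>B. \<Prod>i\<in>UNIV. (1 + a * \<bar>real_of_int (k$i)\<bar>) powr (- s))"
    by (intro sum_mono factor)
  also have "\<dots> = (\<Prod>i\<in>(UNIV::'d set). \<Sum>j\<in>{- int R..int R}. (1 + a * \<bar>real_of_int j\<bar>) powr (- s))"
    unfolding B_def
    by (rule sum_vec_box_prod[where J = "\<lambda>_. {- int R..int R}" and g = "\<lambda>_ j. (1 + a * \<bar>real_of_int j\<bar>) powr (- s)"]) simp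
  also have "\<dots> \<le> (\<Prod>i\<in>(UNIV::'d set). 1 + 2 / (a * (s - 1)))"
    by (intro prod_mono conjI sum_nonneg sum_int_shifted_powr_le a s) auto
  finally show ?thesis by (simp add: s_def)
qed

lemma summable_lattice_powr:
  fixes K :: real
  assumes a: "a > 0" and K: "K > real CARD('d)"
  shows "(\<lambda>k::int^'d. (1 + a * norm (rvec k)) powr (- K)) summable_on UNIV"
  by (rule nonneg_bdd_above_summable_on)
     (auto intro!: bdd_aboveI2 sum_lattice_powr_le_power[OF a K])

text \<open>Omitting the origin is what makes this bound scale like a Riemann sum
  also for large \<open>a\<close>.\<close>
lemma sum_lattice_powr_le:
  fixes K :: real
  assumes K: "K > real CARD('d)"
  shows "\<exists>Z>0. \<forall>a>0. \<forall>A. finite A \<longrightarrow> (0::int^'d) \<notin> A \<longrightarrow>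
           (\<Sum>k\<in>A. (1 + a * norm (rvec k)) powr (- K)) \<le> Z * a powr (- real CARD('d))"
proof -
  define t where "t = K / real CARD('d) - 1"
  have t: "t > 0" using K by (simp add: t_def)
  define Z where "Z = 2 powr K * (1 + 2 / t) ^ CARD('d)"
  have Kpos: "K > 0" using K by (smt (verit) of_nat_0_le_iff)
  have Z: "Z > 0" using t by (simp add: Z_def add_pos_nonneg)
  have "(\<Sum>k\<in>A. (1 + a * norm (rvec k)) powr (- K)) \<le> Z * a powr (- real CARD('d))"
    if a: "a > 0" and A: "finite A" "(0::int^'d) \<notin> A" for a :: real and A
  proof (cases "a \<le> 1")
    case True
    \<comment> \<open>For small \<open>a\<close> the bound that includes the origin already scales
      correctly, since 1 <= 1 / a. The factor \<open>2 powr K\<close> in \<open>Z\<close> is there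
      for the other case.\<close>
    have "(1::real) \<le> 2 powr K" using Kpos by (intro ge_one_powr_ge_zero) auto
    have "(\<Sum>k\<in>A. (1 + a * norm (rvec k)) powr (- K)) \<le> (1 + 2 / (a * t)) ^ CARD('d)"
      using sum_lattice_powr_le_power[OF a K A(1)] by (simp add: t_def)
    also have "\<dots> \<le> ((1 + 2 / t) / a) ^ CARD('d)"
      using True a t by (intro power_mono) (auto simp: field_simps)
    also have "\<dots> = (1 + 2 / t) ^ CARD('d) * a powr (- real CARD('d))"
      using a by (simp add: power_divide powr_minus powr_realpow divide_inverse power_mult_distrib power_inverse)
    also have "\<dots> \<le> Z * a powr (- real CARD('d))"
      unfolding Z_def using t mult_right_mono[OF \<open>1 \<le> 2 powr K\<close>, of "(1 + 2 / t) ^ CARD('d)"]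
      by (intro mult_right_mono) auto
    finally show ?thesis .
  next
    case False
    \<comment> \<open>Away from the origin \<open>(1 + norm (rvec k)) / 2 <= norm (rvec k)\<close>,
      which lets a whole factor \<open>a powr (- K)\<close> come out. For a > 1 it is at most
      a^-d.\<close>
    have bd: "(1 + a * norm (rvec k)) powr (- K) \<le> 2 powr K * a powr (- real CARD('d)) * (1 + 1 * norm (rvec k)) powr (- K)"
      if "k \<in> A" for k
    proof -
      have k1: "norm (rvec k) \<ge> 1" using that A by (intro norm_rvec_ge_1) auto
      have "(1 + a * norm (rvec k)) powr (- K) \<le> (a * ((1 + norm (rvec k)) / 2)) powr (- K)"
      proof (rule powr_mono2')
        have "a * ((1 + norm (rvec k)) / 2) \<le> a * norm (rvec k)"
          using a k1 by (intro mult_left_mono) auto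
        then show "a * ((1 + norm (rvec k)) / 2) \<le> 1 + a * norm (rvec k)" by simp
      qed (use a Kpos k1 in auto)
      also have "\<dots> = 2 powr K * a powr (- K) * (1 + norm (rvec k)) powr (- K)"
        unfolding powr_mult powr_divide using a by (simp add: powr_minus divide_simps)
      also have "\<dots> \<le> 2 powr K * a powr (- real CARD('d)) * (1 + norm (rvec k)) powr (- K)"
        using False K by (intro mult_right_mono mult_left_mono powr_mono) auto
      finally show ?thesis by simp
    qed
    have "(\<Sum>k\<in>A. (1 + a * norm (rvec k)) powr (- K))
        \<le> 2 powr K * a powr (- real CARD('d)) * (\<Sum>k\<in>A. (1 + 1 * norm (rvec k)) powr (- K))"
      unfolding sum_distrib_left by (intro sum_mono bd)
    also have "\<dots> \<le> 2 powr K * a powr (- real CARD('d)) * (1 + 2 / t) ^ CARD('d)"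
      using sum_lattice_powr_le_power[OF zero_less_one K A(1)] by (intro mult_left_mono) (auto simp: t_def)
    finally show ?thesis by (simp add: Z_def mult_ac)
  qed
  with Z show ?thesis by blast
qed

text \<open>Peetre's inequality: 1 + |m| <= (1 + |x + m|)(1 + |x|), raised to the power
  \<open>T\<close>. It makes decay along the lattice uniform under bounded shifts.\<close>

lemma powr_shift_le:
  fixes x m :: "'a::real_normed_vector"
  assumes "T \<ge> 0"
  shows "(1 + norm (x + m)) powr (- T) \<le> (1 + norm x) powr T * (1 + norm m) powr (- T)"
proof -
  have "norm m \<le> norm (x + m) + norm x"
    using norm_triangle_ineq4[of "x + m" x] by simp
  moreover have "0 \<le> norm (x + m) * norm x" by simp
  ultimately have "1 + norm m \<le> (1 + norm (x + m)) * (1 + norm x)"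
    unfolding distrib_left distrib_right by linarith
  then have "(1 + norm m) powr T \<le> ((1 + norm (x + m)) * (1 + norm x)) powr T"
    using assms by (intro powr_mono2) auto
  also have "\<dots> = (1 + norm (x + m)) powr T * (1 + norm x) powr T"
    by (simp add: powr_mult)
  finally have "(1 + norm m) powr T \<le> (1 + norm (x + m)) powr T * (1 + norm x) powr T" .
  moreover have "1 + norm (x + m) > 0" "1 + norm m > 0" by (simp_all add: add_pos_nonneg)
  ultimately show ?thesis by (simp add: powr_minus divide_simps mult.commute)
qed

section \<open>Characters and integration over the unit cube\<close>

text \<open>A fundamental domain of the integer lattice. It is closed in order to be compact, and
  centred so that \<open>rvec m + \<theta>\<close> stays away from 0 whenever \<open>m\<close> is
  nonzero and \<open>\<theta>\<close> lies in the cube.\<close>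

definition centered_cube :: "(real^'d) set" where
  "centered_cube = cbox (\<chi> i. - 1/2) (\<chi> i. 1/2)"

lemma mem_centered_cube: "x \<in> centered_cube \<longleftrightarrow> (\<forall>i. \<bar>x$i\<bar> \<le> 1/2)"
  unfolding centered_cube_def mem_box_cart abs_le_iff by (intro iff_allI) auto

lemma norm_le_on_centered_cube:
  assumes "(x::real^'d) \<in> centered_cube"
  shows "norm x \<le> real CARD('d)"
proof -
  have "norm x \<le> (\<Sum>i\<in>UNIV. \<bar>x$i\<bar>)" by (rule norm_le_l1_cart)
  also have "\<dots> \<le> (\<Sum>i\<in>(UNIV::'d set). 1)"
  proof (rule sum_mono)
    fix i show "\<bar>x$i\<bar> \<le> 1" using assms[unfolded mem_centered_cube, rule_format, of i] by linarith
  qed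
  finally show ?thesis by simp
qed

definition echar :: "real^'d \<Rightarrow> real^'d \<Rightarrow> complex" where
  "echar \<xi> x = cis (2 * pi * (\<xi> \<bullet> x))"

lemma norm_echar [simp]: "norm (echar \<xi> x) = 1"
  by (simp add: echar_def)

lemma echar_0 [simp]: "echar 0 x = 1" "echar \<xi> 0 = 1"
  by (simp_all add: echar_def)

lemma echar_add_left: "echar (\<xi> + \<eta>) x = echar \<xi> x * echar \<eta> x"
  by (simp add: echar_def inner_add_left cis_mult ring_distribs)

lemma echar_add_right: "echar \<xi> (x + y) = echar \<xi> x * echar \<xi> y"
  by (simp add: echar_def inner_add_right cis_mult ring_distribs)

lemma cis_2pi_int [simp]: "cis (2 * pi * real_of_int m) = 1"
  using cis_multiple_2pi[of "real_of_int m"] by simp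

lemma rvec_inner_rvec_Ints: "rvec k \<bullet> rvec m \<in> \<int>"
  by (auto simp: inner_vec_def intro!: Ints_sum)

lemma echar_rvec_rvec [simp]: "echar (rvec k) (rvec m) = 1"
  using rvec_inner_rvec_Ints[of k m] by (auto simp: echar_def elim!: Ints_cases)

lemma continuous_on_echar [continuous_intros]: "continuous_on S (echar \<xi>)"
  unfolding echar_def by (intro continuous_intros)

lemma borel_measurable_echar [measurable]: "echar \<xi> \<in> borel_measurable borel"
  by (rule borel_measurable_continuous_onI) (rule continuous_on_echar)

lemma has_integral_cis_period:
  "((\<lambda>t. cis (2 * pi * real_of_int j * t)) has_integral (if j = 0 then 1 else 0)) {-1/2..1/2}"
proof (cases "j = 0")
  case True
  then show ?thesis using has_integral_const_real[of "1::complex" "-1/2" "1/2"] by simp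
next
  case False
  define c where "c = 2 * pi * real_of_int j"
  have c: "c \<noteq> 0" using False by (simp add: c_def)
  let ?F = "\<lambda>t. - \<i> / of_real c * cis (c * t)"
  have D: "(?F has_vector_derivative cis (c * t)) (at t)" for t
    unfolding has_vector_derivative_def using c
    by (auto intro!: derivative_eq_intros simp: scaleR_conv_of_real fun_eq_iff)
       (simp add: complex_eq_iff)
  have "((\<lambda>t. cis (c * t)) has_integral (?F (1/2) - ?F (-1/2))) {-1/2..1/2}"
    by (rule fundamental_theorem_of_calculus)
       (use D in \<open>auto intro: has_vector_derivative_at_within\<close>)
  moreover have "cis (c * (1/2)) = cis (c * (-1/2)) * cis c" by (simp add: cis_mult)
  then have "?F (1/2) = ?F (-1/2)" by (simp add: c_def)
  ultimately show ?thesis using False by (simp add: c_def)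
qed

text \<open>Fubini for products: \<open>lborel\<close> is defined as an image of a product of
  one-dimensional measures.\<close>

lemma lborel_integral_prod_components:
  fixes f :: "'a::euclidean_space \<Rightarrow> real \<Rightarrow> complex"
  assumes "\<And>b. b \<in> Basis \<Longrightarrow> integrable lborel (f b)"
  shows "(\<integral>x. (\<Prod>b\<in>Basis. f b (x \<bullet> b)) \<partial>lborel) = (\<Prod>b\<in>Basis. \<integral>t. f b t \<partial>lborel)"
proof -
  interpret product_sigma_finite "\<lambda>_::'a. interval_measure (\<lambda>x. x)"
    by (simp add: product_sigma_finite_def sigma_finite_interval_measure)
  have [measurable]: "f b \<in> borel_measurable borel" if "b \<in> Basis" for b
    using assms[OF that] by (auto dest: borel_measurable_integrable)
  have "(\<integral>x. (\<Prod>b\<in>Basis. f b (x \<bullet> b)) \<partial>lborel)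
      = (\<integral>p. (\<Prod>b\<in>Basis. f b (p b)) \<partial>(\<Pi>\<^sub>M b\<in>(Basis::'a set). interval_measure (\<lambda>x. x)))"
    by (simp add: lborel_def integral_distr)
  also have "\<dots> = (\<Prod>b\<in>Basis. \<integral>t. f b t \<partial>interval_measure (\<lambda>x. x))"
    by (rule product_integral_prod) (use assms in \<open>auto simp: lborel_eq_real\<close>)
  finally show ?thesis by (simp add: lborel_eq_real)
qed

text \<open>Orthogonality of characters. The indicator of the cube and the character both factor
  over the coordinates, leaving integrals over one full period.\<close>

lemma integral_echar_cube:
  fixes k :: "int^'d"
  shows "integral centered_cube (echar (rvec k)) = (if k = 0 then 1 else 0)"
proof -
  let ?I = "{-1/2..1/2::real}"
  define f where "f b t = indicator ?I t *\<^sub>R cis (2 * pi * (rvec k \<bullet> b) * t)" for b :: "real^'d" and t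
  have int: "set_integrable lborel ?I (\<lambda>t. cis (c * t))" for c
    unfolding set_integrable_def by (intro borel_integrable_compact continuous_intros) auto
  have intf: "integrable lborel (f b)" for b
    using int[of "2 * pi * (rvec k \<bullet> b)"] by (simp add: f_def[abs_def] set_integrable_def)
  have prod: "(\<Prod>b\<in>Basis. f b (x \<bullet> b)) = indicator centered_cube x *\<^sub>R echar (rvec k) x" for x
  proof (cases "x \<in> centered_cube")
    case True
    then have "f b (x \<bullet> b) = cis (2 * pi * (rvec k \<bullet> b) * (x \<bullet> b))" if "b \<in> Basis" for b
    proof -
      obtain i where i: "b = axis i 1" using \<open>b \<in> Basis\<close> by (auto simp: Basis_vec_def)
      have "\<bar>x$i\<bar> \<le> 1/2" using True by (simp add: mem_centered_cube)
      then have "x$i \<in> ?I" by (auto simp: abs_le_iff)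
      then show ?thesis by (simp add: f_def i inner_axis)
    qed
    then have "(\<Prod>b\<in>Basis. f b (x \<bullet> b)) = exp (\<Sum>b\<in>Basis. \<i> * of_real (2 * pi * (rvec k \<bullet> b) * (x \<bullet> b)))"
      by (simp add: cis_conv_exp exp_sum)
    also have "(\<Sum>b\<in>Basis. \<i> * of_real (2 * pi * (rvec k \<bullet> b) * (x \<bullet> b))) = \<i> * of_real (2 * pi * (rvec k \<bullet> x))"
      by (simp add: euclidean_inner[of "rvec k" x] sum_distrib_left mult.assoc)
    finally show ?thesis using True by (simp add: echar_def cis_conv_exp)
  next
    case False
    then obtain i where "\<bar>x$i\<bar> > 1/2" by (auto simp: mem_centered_cube not_le)
    then have "f (axis i 1) (x \<bullet> axis i 1) = 0"
      by (auto simp: f_def inner_axis split: split_indicator)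
    moreover have "axis i 1 \<in> (Basis::(real^'d) set)" by (auto simp: Basis_vec_def)
    ultimately show ?thesis using False by (auto intro!: prod_zero)
  qed
  have one: "(\<integral>t. f b t \<partial>lborel) = (if rvec k \<bullet> b = 0 then 1 else 0)" if b: "b \<in> Basis" for b
  proof -
    obtain i where "b = axis i 1" using b by (auto simp: Basis_vec_def)
    then have "(\<integral>t. f b t \<partial>lborel) = (LINT t:?I|lborel. cis (2 * pi * real_of_int (k$i) * t))"
      by (simp add: f_def set_lebesgue_integral_def inner_axis)
    also have "\<dots> = integral ?I (\<lambda>t. cis (2 * pi * real_of_int (k$i) * t))"
      by (rule set_borel_integral_eq_integral(2)[OF int])
    also have "\<dots> = (if k$i = 0 then 1 else 0)" by (rule integral_unique[OF has_integral_cis_period])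
    finally show ?thesis using \<open>b = axis i 1\<close> by (simp add: inner_axis)
  qed
  have "set_integrable lborel centered_cube (echar (rvec k))"
    unfolding centered_cube_def set_integrable_def by (intro borel_integrable_compact continuous_intros) auto
  then have "integral centered_cube (echar (rvec k)) = (LINT x:centered_cube|lborel. echar (rvec k) x)"
    by (rule set_borel_integral_eq_integral(2)[symmetric])
  also have "\<dots> = (\<Prod>b\<in>Basis. \<integral>t. f b t \<partial>lborel)"
    unfolding set_lebesgue_integral_def prod[symmetric] by (rule lborel_integral_prod_components[OF intf])
  also have "\<dots> = (\<Prod>b\<in>(Basis::(real^'d) set). if rvec k \<bullet> b = 0 then 1 else 0)" by (simp add: one)
  also have "\<dots> = (if k = 0 then 1 else 0)"
  proof (cases "k = 0")
    case False
    then have "\<not> (\<forall>b\<in>Basis. rvec k \<bullet> b = 0)"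
      using euclidean_all_zero_iff[of "rvec k"] by simp
    with False show ?thesis by (auto intro!: prod_zero)
  qed simp
  finally show ?thesis .
qed

text \<open>Weierstrass M-test along the net of finite index sets; uniform convergence preserves
  continuity and allows termwise integration on the compact cube.\<close>

lemma infsum_on_cube:
  fixes f :: "'i \<Rightarrow> real^'d \<Rightarrow> complex"
  assumes cont: "\<And>i. continuous_on centered_cube (f i)"
    and le: "\<And>i x. x \<in> centered_cube \<Longrightarrow> norm (f i x) \<le> M i"
    and M: "M summable_on UNIV"
  shows "continuous_on centered_cube (\<lambda>x. \<Sum>\<^sub>\<infinity>i. f i x)" (is ?A)
    and "((\<lambda>i. integral centered_cube (f i)) has_sum integral centered_cube (\<lambda>x. \<Sum>\<^sub>\<infinity>i. f i x)) UNIV" (is ?B)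
proof -
  have ul: "uniform_limit centered_cube (\<lambda>X x. \<Sum>i\<in>X. f i x) (\<lambda>x. \<Sum>\<^sub>\<infinity>i. f i x) (finite_subsets_at_top UNIV)"
    by (rule Weierstrass_m_test_general[OF le M])
  show ?A
    by (rule uniform_limit_theorem[OF _ ul]) (auto intro!: continuous_on_sum cont eventuallyI)
  obtain I J where IJ: "\<And>X. ((\<lambda>x. \<Sum>i\<in>X. f i x) has_integral I X) centered_cube"
    "((\<lambda>x. \<Sum>\<^sub>\<infinity>i. f i x) has_integral J) centered_cube" "(I \<longlongrightarrow> J) (finite_subsets_at_top UNIV)"
    unfolding centered_cube_def
    by (rule uniform_limit_integral_cbox[OF ul[unfolded centered_cube_def]])
       (rule continuous_on_sum, rule cont[unfolded centered_cube_def], simp, blast)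
  have int: "f i integrable_on centered_cube" for i
    using cont[of i] unfolding centered_cube_def by (rule integrable_continuous)
  have "I X = (\<Sum>i\<in>X. integral centered_cube (f i))" if "finite X" for X
    using has_integral_sum[OF that integrable_integral[OF int]] IJ(1)[of X] by (rule has_integral_unique[symmetric])
  then have "((\<lambda>X. \<Sum>i\<in>X. integral centered_cube (f i)) \<longlongrightarrow> J) (finite_subsets_at_top UNIV)"
    by (intro Lim_transform_eventually[OF IJ(3)] eventually_finite_subsets_at_top_weakI) auto
  then show ?B using integral_unique[OF IJ(2)] by (simp add: has_sum_def)
qed

lemma compact_centered_cube: "compact centered_cube"
  by (simp add: centered_cube_def)

lemma integrable_on_centered_cube:
  "continuous_on centered_cube f \<Longrightarrow> f integrable_on centered_cube"
  for f :: "real^'d \<Rightarrow> 'b::euclidean_space"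
  unfolding centered_cube_def by (rule integrable_continuous)

section \<open>Uniqueness of Fourier coefficients\<close>

text \<open>One cosine factor of the kernel only mixes the frequencies \<open>k\<close> and
  \<open>k\<close> plus or minus a unit vector. Multiplying by it therefore preserves the property
  that all Fourier coefficients vanish.\<close>

lemma cos_weight_echar:
  fixes k :: "int^'d"
  shows "of_real ((1 + cos (2 * pi * (x$i))) / 2) * echar (rvec k) x
    = 1/2 * echar (rvec k) x + 1/4 * echar (rvec (k + axis i 1)) x + 1/4 * echar (rvec (k - axis i 1)) x"
proof -
  define e where "e = cis (2 * pi * (x$i))"
  have ax: "rvec (axis i 1) = axis i 1" by (auto simp: vec_eq_iff axis_def)
  have "echar (rvec (k + axis i 1)) x = echar (rvec k) x * e"
    "echar (rvec (k - axis i 1)) x = echar (rvec k) x * cnj e"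
    by (simp_all add: rvec_add rvec_diff ax echar_def e_def cis_cnj cis_mult inner_add_left inner_diff_left
        inner_axis' ring_distribs)
  moreover have "of_real ((1 + cos (2 * pi * (x$i))) / 2) = (2 + e + cnj e) / 4"
    by (simp add: e_def complex_eq_iff)
  ultimately show ?thesis by (simp only:) (simp add: field_simps)
qed

text \<open>The kernels \<open>q\<^sup>n\<close> with \<open>q = \<Prod>i. (1 + cos (2\<pi>x\<^sub>i))/2\<close> are nonnegative
  trigonometric polynomials that concentrate at the origin of the cube.\<close>
lemma vanishing_fourier_coeffs_imp_zero:
  fixes H :: "real^'d \<Rightarrow> complex"
  assumes cont: "continuous_on centered_cube H"
    and zero: "\<And>k::int^'d. integral centered_cube (\<lambda>x. H x * echar (rvec k) x) = 0"
  shows "H 0 = 0"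
proof -
  let ?Q = "centered_cube :: (real^'d) set"
  define w :: "'d \<Rightarrow> real^'d \<Rightarrow> real" where "w i x = (1 + cos (2 * pi * (x$i))) / 2" for i x
  define q where "q x = (\<Prod>i\<in>UNIV. w i x)" for x
  \<comment> \<open>\<open>P g\<close> says that the product of \<open>H\<close> and
    \<open>g\<close> has no nonzero Fourier coefficient. Closure under each weight
    \<open>w i\<close> carries this to all powers of \<open>q\<close>, without expanding them as
    trigonometric polynomials.\<close>
  define P where "P g \<longleftrightarrow> continuous_on ?Q g \<and>
      (\<forall>k::int^'d. integral ?Q (\<lambda>x. H x * g x * echar (rvec k) x) = 0)" for g :: "real^'d \<Rightarrow> complex"
  have w01: "0 \<le> w i x" "w i x \<le> 1" for i x
  proof -
    have "0 \<le> (1 + c) / 2 \<and> (1 + c) / 2 \<le> 1" if "- 1 \<le> c" "c \<le> 1" for c :: real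
      using that by auto
    from this[OF cos_ge_minus_one cos_le_one] show "0 \<le> w i x" "w i x \<le> 1"
      unfolding w_def by blast+
  qed
  have contw: "continuous_on S (w i)" for S i
    unfolding w_def by (intro continuous_intros) auto
  have contq: "continuous_on S q" for S
    unfolding q_def by (intro continuous_on_prod contw)
  have q01: "0 \<le> q x" "q x \<le> 1" for x
    unfolding q_def using w01 by (auto intro!: prod_nonneg prod_le_1)
  have P_w: "P (\<lambda>x. of_real (w i x) * g x)" if "P g" for g i
  proof -
    have cg: "continuous_on ?Q g" using that by (simp add: P_def)
    have int: "(\<lambda>x. H x * g x * echar (rvec k) x) integrable_on ?Q" for k
      by (intro integrable_on_centered_cube continuous_intros cont cg)
    have "integral ?Q (\<lambda>x. H x * (of_real (w i x) * g x) * echar (rvec k) x) = 0" for k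
    proof -
      have "(\<lambda>x. H x * (of_real (w i x) * g x) * echar (rvec k) x) = (\<lambda>x. H x * g x * (of_real (w i x) * echar (rvec k) x))"
        by (simp add: mult_ac)
      also have "\<dots> = (\<lambda>x. 1/2 * (H x * g x * echar (rvec k) x) + 1/4 * (H x * g x * echar (rvec (k + axis i 1)) x)
          + 1/4 * (H x * g x * echar (rvec (k - axis i 1)) x))"
        unfolding w_def cos_weight_echar by (simp add: algebra_simps)
      finally have eq: "(\<lambda>x. H x * (of_real (w i x) * g x) * echar (rvec k) x) = \<dots>" .
      have "integral ?Q (\<lambda>x. H x * g x * echar (rvec l) x) = 0" for l :: "int^'d"
        using that by (simp add: P_def)
      then show ?thesis unfolding eq using int
        by (simp add: integral_add integrable_add integrable_on_mult_right)
    qed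
    then show ?thesis using cg by (auto simp: P_def intro!: continuous_intros contw)
  qed
  have P_prod: "P (\<lambda>x. of_real (\<Prod>i\<in>I. w i x) * g x)" if "P g" "finite I" for g I
    using that(2,1)
  proof (induction I rule: finite_induct)
    case (insert i I)
    then show ?case using P_w[of "\<lambda>x. of_real (\<Prod>i\<in>I. w i x) * g x" i] by (simp add: mult.assoc)
  qed simp
  have P_q: "P (\<lambda>x. of_real (q x) ^ n)" for n
  proof (induction n)
    case 0
    then show ?case using zero by (simp add: P_def)
  next
    case (Suc n)
    then show ?case using P_prod[OF Suc, of UNIV] by (simp add: q_def)
  qed
  have int0: "integral ?Q (\<lambda>x. H x * of_real (q x ^ n)) = 0" for n
    using P_q[of n] unfolding P_def by (auto dest: spec[of _ 0])
  have Q0: "0 \<in> interior ?Q"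
    by (simp add: centered_cube_def interior_cbox mem_box_cart)
  then have Q0': "0 \<in> ?Q" using interior_subset by blast
  obtain B where B: "\<And>x. x \<in> ?Q \<Longrightarrow> norm (H 0 - H x) \<le> B"
  proof -
    have "bounded ((\<lambda>x. H 0 - H x) ` ?Q)"
      by (intro compact_imp_bounded compact_continuous_image compact_centered_cube continuous_intros cont)
    then show ?thesis using that by (auto simp: bounded_iff)
  qed
  have B0: "B \<ge> 0" using B[OF Q0'] by simp
  have "norm (H 0) \<le> \<delta>" if \<delta>: "\<delta> > 0" for \<delta>
  proof (rule ccontr)
    assume "\<not> norm (H 0) \<le> \<delta>"
    obtain r where r: "r > 0" "\<And>x. x \<in> ?Q \<Longrightarrow> norm x < r \<Longrightarrow> norm (H 0 - H x) < \<delta>"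
      using cont[unfolded continuous_on_iff, rule_format, OF Q0' \<delta>] by (auto simp: dist_norm norm_minus_commute)
    define D where "D = {x \<in> ?Q. r \<le> norm x}"
    have "compact D"
    proof -
      have "closed {x::real^'d. r \<le> norm x}" by (intro closed_Collect_le continuous_intros)
      moreover have "D = ?Q \<inter> {x. r \<le> norm x}" by (auto simp: D_def)
      ultimately show ?thesis by (simp add: compact_Int_closed compact_centered_cube)
    qed
    \<comment> \<open>Inside the cube, cos (2 pi t) equals 1 only at t = 0, so the origin is the
      only maximum of \<open>q\<close>.\<close>
    have q_lt_1: "q x < 1" if "x \<in> D" for x
    proof -
      have "x \<noteq> 0" using that r by (auto simp: D_def)
      then obtain i where i: "x$i \<noteq> 0" by (auto simp: vec_eq_iff)
      have "\<bar>x$i\<bar> \<le> 1/2" using that unfolding D_def mem_centered_cube by blast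
      then have "\<bar>2 * pi * (x$i)\<bar> \<le> pi" by (simp add: abs_mult)
      then have "cos \<bar>2 * pi * (x$i)\<bar> < cos 0" using i by (intro cos_monotone_0_pi) auto
      then have "cos (2 * pi * (x$i)) < 1" by (simp only: cos_abs_real cos_zero)
      then have "w i x < 1" by (simp add: w_def)
      moreover have "q x = w i x * (\<Prod>j\<in>UNIV - {i}. w j x)" unfolding q_def by (simp add: prod.remove)
      moreover have "(\<Prod>j\<in>UNIV - {i}. w j x) \<le> 1" using w01 by (auto intro!: prod_le_1)
      ultimately show ?thesis using w01[of i x] by (smt (verit) mult_left_le)
    qed
    obtain lam where lam: "0 \<le> lam" "lam < 1" "\<And>x. x \<in> D \<Longrightarrow> q x \<le> lam"
    proof (cases "D = {}")
      case True
      then show ?thesis using that[of 0] by simp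
    next
      case False
      then obtain y where "y \<in> D" "\<And>x. x \<in> D \<Longrightarrow> q x \<le> q y"
        using continuous_attains_sup[OF \<open>compact D\<close> False contq] by auto
      then show ?thesis using that[of "q y"] q01 q_lt_1 by auto
    qed
    \<comment> \<open>A level strictly between the maximum \<open>lam\<close> away from the origin
      and the value 1 at the origin. A box on which \<open>q\<close> exceeds it gives the integral
      of q^n the lower bound c \<mu>^n, which dominates the outer part of order lam^n.\<close>
    define \<mu> where "\<mu> = (1 + lam) / 2"
    have \<mu>: "0 < \<mu>" "lam < \<mu>" "\<mu> < 1" using lam by (auto simp: \<mu>_def)
    have "open (interior ?Q \<inter> {x. q x > \<mu>})"
      by (intro open_Int open_Collect_less contq continuous_intros) auto
    moreover have "0 \<in> interior ?Q \<inter> {x. q x > \<mu>}" using Q0 \<mu> by (simp add: q_def w_def)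
    ultimately obtain a b where ab: "cbox a b \<subseteq> interior ?Q \<inter> {x. q x > \<mu>}"
      "\<forall>i\<in>Basis. a \<bullet> i < b \<bullet> i" by (rule open_contains_cbox)
    define c where "c = measure lborel (cbox a b)"
    have c: "c > 0" unfolding c_def by (rule content_pos_lt[OF ab(2)])
    have intq: "(\<lambda>x. q x ^ n) integrable_on ?Q" for n
      by (intro integrable_on_centered_cube continuous_intros contq)
    have low: "c * \<mu> ^ n \<le> integral ?Q (\<lambda>x. q x ^ n)" for n
    proof -
      have "c * \<mu> ^ n = integral (cbox a b) (\<lambda>x. \<mu> ^ n)" by (simp add: c_def)
      also have "\<dots> \<le> integral (cbox a b) (\<lambda>x. q x ^ n)"
        using ab(1) \<mu> by (intro integral_le integrable_continuous continuous_intros contq power_mono) auto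
      also have "\<dots> \<le> integral ?Q (\<lambda>x. q x ^ n)"
        using ab(1) interior_subset[of ?Q] q01
        by (intro integral_subset_le intq integrable_continuous continuous_intros contq) auto
      finally show ?thesis .
    qed
    define V where "V = measure lborel ?Q"
    \<comment> \<open>As \<open>H\<close> is orthogonal to q^n, it may be subtracted for free. The
      remaining integrand (H 0 - H x) q^n is small by continuity within radius \<open>r\<close> and
      by the size of \<open>q\<close> beyond it.\<close>
    have up: "norm (H 0) * integral ?Q (\<lambda>x. q x ^ n) \<le> \<delta> * integral ?Q (\<lambda>x. q x ^ n) + B * lam ^ n * V" for n
    proof -
      have "H 0 * of_real (integral ?Q (\<lambda>x. q x ^ n)) = integral ?Q (\<lambda>x. H 0 * of_real (q x ^ n))"
        using integral_linear[OF intq[of n] bounded_linear_of_real[where 'a = complex]]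
        by (simp add: o_def)
      also have "\<dots> = integral ?Q (\<lambda>x. H 0 * of_real (q x ^ n)) - integral ?Q (\<lambda>x. H x * of_real (q x ^ n))"
        by (simp only: int0 diff_zero)
      also have "\<dots> = integral ?Q (\<lambda>x. (H 0 - H x) * of_real (q x ^ n))"
        unfolding left_diff_distrib
        by (intro integral_diff[symmetric] integrable_on_centered_cube continuous_intros contq cont)
      finally have "norm (H 0) * \<bar>integral ?Q (\<lambda>x. q x ^ n)\<bar> = norm (integral ?Q (\<lambda>x. (H 0 - H x) * of_real (q x ^ n)))"
        by (metis norm_mult norm_of_real)
      also have "\<dots> \<le> integral ?Q (\<lambda>x. \<delta> * q x ^ n + B * lam ^ n)"
      proof (rule integral_norm_bound_integral)
        fix x assume x: "x \<in> ?Q"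
        show "norm ((H 0 - H x) * of_real (q x ^ n)) \<le> \<delta> * q x ^ n + B * lam ^ n"
        proof (cases "norm x < r")
          case True
          have "norm (H 0 - H x) * q x ^ n \<le> \<delta> * q x ^ n"
            using r(2)[OF x True] q01 by (intro mult_right_mono) auto
          then show ?thesis using B0 lam q01 by (simp add: norm_mult norm_power add_increasing2)
        next
          case False
          have "norm (H 0 - H x) * q x ^ n \<le> B * lam ^ n"
            using B[OF x] lam(3)[of x] x False q01 B0 by (intro mult_mono power_mono) (auto simp: D_def)
          then show ?thesis using \<delta> q01 by (simp add: norm_mult norm_power add_increasing)
        qed
      qed (intro integrable_on_centered_cube continuous_intros contq cont)+
      also have "\<dots> = \<delta> * integral ?Q (\<lambda>x. q x ^ n) + B * lam ^ n * V"
        using intq[of n] integrable_const[of "B * lam ^ n"]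
        by (simp add: integral_add integrable_on_mult_right integrable_on_centered_cube V_def)
           (simp add: centered_cube_def)
      finally show ?thesis using q01 by (smt (verit) integral_nonneg[OF intq] zero_le_power mult_left_mono norm_ge_zero)
    qed
    define \<eta> where "\<eta> = norm (H 0) - \<delta>"
    have \<eta>: "\<eta> > 0" using \<open>\<not> norm (H 0) \<le> \<delta>\<close> by (simp add: \<eta>_def)
    have "\<eta> * c \<le> B * V * (lam / \<mu>) ^ n" for n
    proof -
      have "\<eta> * (c * \<mu> ^ n) \<le> \<eta> * integral ?Q (\<lambda>x. q x ^ n)" using low \<eta> by (intro mult_left_mono) auto
      also have "\<dots> \<le> B * lam ^ n * V" using up[of n] by (simp add: \<eta>_def left_diff_distrib)
      finally show ?thesis using \<mu> by (simp add: power_divide field_simps)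
    qed
    moreover have "(\<lambda>n. B * V * (lam / \<mu>) ^ n) \<longlonglongrightarrow> B * V * 0"
      using lam \<mu> by (intro tendsto_intros LIMSEQ_power_zero) auto
    ultimately have "\<eta> * c \<le> B * V * 0" by (intro LIMSEQ_le_const) auto
    then show False using \<eta> c by (simp add: mult_le_0_iff)
  qed
  then have "norm (H 0) \<le> 0" by (rule dense_ge)
  then show ?thesis by simp
qed

section \<open>Poisson summation\<close>

lemma integral_shift_cube:
  fixes g :: "real^'d \<Rightarrow> complex"
  assumes "continuous_on UNIV g"
  shows "integral centered_cube (\<lambda>x. g (x + v)) = integral (cbox (v + (\<chi> i. - 1/2)) (v + (\<chi> i. 1/2))) g"
proof -
  let ?a = "v + (\<chi> i. - 1/2)" and ?b = "v + (\<chi> i. 1/2)"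
  have "(g has_integral integral (cbox ?a ?b) g) (cbox ?a ?b)"
    by (intro integrable_integral integrable_continuous continuous_on_subset[OF assms]) auto
  from has_integral_affinity'[OF this zero_less_one, of v]
  have "((\<lambda>x. g (x + v)) has_integral integral (cbox ?a ?b) g) centered_cube"
    by (simp add: centered_cube_def)
  then show ?thesis by (rule integral_unique)
qed

lemma infinite_int_vec: "infinite (UNIV :: (int^'d) set)"
proof
  assume "finite (UNIV :: (int^'d) set)"
  moreover have "inj (\<lambda>n::int. (\<chi> i. n) :: int^'d)" by (auto simp: inj_def vec_eq_iff)
  ultimately have "finite (UNIV::int set)" by (metis finite_imageD finite_subset subset_UNIV)
  then show False by simp
qed

text \<open>Space is tiled by integer translates of the cube, and countable additivity of the
  integral sums the pieces.\<close>

lemma integral_UNIV_unfold: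
  fixes g :: "real^'d \<Rightarrow> complex"
  assumes cont: "continuous_on UNIV g" and int: "integrable lborel g"
    and S: "((\<lambda>m::int^'d. integral centered_cube (\<lambda>x. g (x + rvec m))) has_sum S) UNIV"
  shows "integral UNIV g = S"
proof -
  \<comment> \<open>Countable additivity is stated for sequences, so the lattice is enumerated;
    having an unconditional sum \<open>S\<close> makes the order immaterial.\<close>
  define b :: "nat \<Rightarrow> int^'d" where "b = from_nat_into UNIV"
  have b: "bij b" unfolding b_def
    by (rule bij_betw_from_nat_into) (auto simp: infinite_int_vec)
  \<comment> \<open>Half-open cubes form an exact partition; they differ from the closed ones only
    in the negligible boundary.\<close>
  define A :: "int^'d \<Rightarrow> (real^'d) set" where "A m = {x. \<forall>i. real_of_int (m$i) \<le> x$i + 1/2 \<and> x$i + 1/2 < real_of_int (m$i) + 1}" for m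
  have A_iff: "x \<in> A m \<longleftrightarrow> m = (\<chi> i. \<lfloor>x$i + 1/2\<rfloor>)" for x m
    by (auto simp: A_def vec_eq_iff floor_eq_iff eq_commute[of "_ $ _" "\<lfloor>_\<rfloor>"])
  have A_sets: "A m \<in> sets lborel" for m
  proof -
    have "{x \<in> space lborel. \<forall>i. real_of_int (m$i) \<le> x$i + 1/2 \<and> x$i + 1/2 < real_of_int (m$i) + 1} \<in> sets lborel"
      by measurable
    then show ?thesis by (simp add: A_def)
  qed
  have A_UN: "(\<Union>n. A (b n)) = UNIV"
    using b by (auto simp: A_iff) (metis bij_pointE)
  have A_int: "(LINT x:A m|lborel. g x) = integral centered_cube (\<lambda>x. g (x + rvec m))" for m
  proof -
    let ?a = "rvec m + (\<chi> i. - 1/2)" and ?b = "rvec m + (\<chi> i. 1/2)"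
    have "set_integrable lborel (A m) g"
      using int A_sets unfolding set_integrable_def by (rule integrable_mult_indicator[rotated])
    then have "(LINT x:A m|lborel. g x) = integral (A m) g"
      by (rule set_borel_integral_eq_integral)
    also have "\<dots> = integral (cbox ?a ?b) g"
    proof (rule integral_spike_set)
      have "box ?a ?b \<subseteq> A m" "A m \<subseteq> cbox ?a ?b"
        unfolding A_def by (auto simp: mem_box_cart algebra_simps less_imp_le) (smt (verit) field_sum_of_halves)+
      then have "{x \<in> A m - cbox ?a ?b. g x \<noteq> 0} \<subseteq> cbox ?a ?b - box ?a ?b"
        "{x \<in> cbox ?a ?b - A m. g x \<noteq> 0} \<subseteq> cbox ?a ?b - box ?a ?b" by blast+
      then show "negligible {x \<in> A m - cbox ?a ?b. g x \<noteq> 0}" "negligible {x \<in> cbox ?a ?b - A m. g x \<noteq> 0}"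
        by (blast intro: negligible_subset[OF negligible_frontier_interval])+
    qed
    finally show ?thesis by (simp add: integral_shift_cube[OF cont])
  qed
  have "(LINT x:(\<Union>n. A (b n))|lborel. g x) = (\<Sum>n. LINT x:A (b n)|lborel. g x)"
  proof (rule lebesgue_integral_countable_add)
    show "A (b i) \<inter> A (b j) = {}" if "i \<noteq> j" for i j
      using b that by (auto simp: A_iff bij_def inj_def)
    show "set_integrable lborel (\<Union>n. A (b n)) g"
      using int by (simp add: A_UN set_integrable_def)
  qed (rule A_sets)
  then have "integral\<^sup>L lborel g = (\<Sum>n. integral centered_cube (\<lambda>x. g (x + rvec (b n))))"
    unfolding A_UN A_int by (simp add: set_lebesgue_integral_def)
  also have "\<dots> = S"
  proof -
    have "((\<lambda>n. integral centered_cube (\<lambda>x. g (x + rvec (b n)))) has_sum S) UNIV"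
      using S has_sum_reindex_bij_betw[OF b, of "\<lambda>m. integral centered_cube (\<lambda>x. g (x + rvec m))" S] by simp
    then show ?thesis by (intro sums_unique[symmetric] has_sum_imp_sums)
  qed
  finally show ?thesis using integral_lborel[OF int] by simp
qed

text \<open>The periodization \<open>F\<close> of \<open>g\<close> and the Fourier series
  \<open>G\<close> with coefficients \<open>ghat\<close> are continuous on the cube and have the
  same Fourier coefficients. Hence they agree at 0, which is the asserted identity.\<close>

theorem poisson_summation:
  fixes g :: "real^'d \<Rightarrow> complex" and ghat :: "int^'d \<Rightarrow> complex"
  assumes cont: "continuous_on UNIV g" and int: "integrable lborel g"
    and bound: "\<And>m x. x \<in> centered_cube \<Longrightarrow> norm (g (x + rvec m)) \<le> M m" and M: "M summable_on UNIV"
    and ghat: "\<And>k. ghat k = integral UNIV (\<lambda>u. g u * echar (rvec (- k)) u)"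
    and sum: "(\<lambda>k. norm (ghat k)) summable_on UNIV"
  shows "(\<Sum>\<^sub>\<infinity>m. g (rvec m)) = (\<Sum>\<^sub>\<infinity>k. ghat k)"
proof -
  let ?Q = "centered_cube :: (real^'d) set"
  have contg: "continuous_on S (\<lambda>x. g (x + v))" for S v
    by (intro continuous_on_compose2[OF cont] continuous_intros) auto
  define F where "F x = (\<Sum>\<^sub>\<infinity>m. g (x + rvec m))" for x
  define G where "G x = (\<Sum>\<^sub>\<infinity>k. ghat k * echar (rvec k) x)" for x
  have contF: "continuous_on ?Q F"
    unfolding F_def by (rule infsum_on_cube(1)[OF contg bound M])
  have contG: "continuous_on ?Q G"
    unfolding G_def
    by (rule infsum_on_cube(1)[where M = "\<lambda>k. norm (ghat k)"]) (auto intro!: continuous_intros sum simp: norm_mult)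
  \<comment> \<open>Unfolding: a character of integer frequency is invariant under lattice shifts,
    so the integrals over all translates combine into one over the whole space.\<close>
  have coeffF: "integral ?Q (\<lambda>x. F x * echar (rvec l) x) = ghat (- l)" for l
  proof -
    have "((\<lambda>m. integral ?Q (\<lambda>x. g (x + rvec m) * echar (rvec l) x)) has_sum
        integral ?Q (\<lambda>x. \<Sum>\<^sub>\<infinity>m. g (x + rvec m) * echar (rvec l) x)) UNIV"
      by (rule infsum_on_cube(2)[OF _ _ M]) (auto intro!: continuous_intros contg bound simp: norm_mult)
    moreover have "(\<Sum>\<^sub>\<infinity>m. g (x + rvec m) * echar (rvec l) x) = F x * echar (rvec l) x" for x
      by (simp add: F_def infsum_cmult_left')
    ultimately have "((\<lambda>m. integral ?Q (\<lambda>x. (g (x + rvec m) * echar (rvec l) (x + rvec m)))) has_sum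
        integral ?Q (\<lambda>x. F x * echar (rvec l) x)) UNIV"
      by (simp add: echar_add_right)
    moreover have "integrable lborel (\<lambda>x. g x * echar (rvec l) x)"
      by (rule Bochner_Integration.integrable_bound[OF int]) (use int in \<open>auto simp: norm_mult\<close>)
    ultimately have "integral UNIV (\<lambda>x. g x * echar (rvec l) x) = integral ?Q (\<lambda>x. F x * echar (rvec l) x)"
      by (intro integral_UNIV_unfold continuous_intros cont)
    then show ?thesis by (simp add: ghat)
  qed
  have coeffG: "integral ?Q (\<lambda>x. G x * echar (rvec l) x) = ghat (- l)" for l
  proof -
    have "((\<lambda>k. integral ?Q (\<lambda>x. ghat k * echar (rvec k) x * echar (rvec l) x)) has_sum
        integral ?Q (\<lambda>x. \<Sum>\<^sub>\<infinity>k. ghat k * echar (rvec k) x * echar (rvec l) x)) UNIV"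
      by (rule infsum_on_cube(2)[where M = "\<lambda>k. norm (ghat k)"]) (auto intro!: continuous_intros sum simp: norm_mult)
    moreover have "(\<Sum>\<^sub>\<infinity>k. ghat k * echar (rvec k) x * echar (rvec l) x) = G x * echar (rvec l) x" for x
      by (simp add: G_def infsum_cmult_left')
    moreover have "integral ?Q (\<lambda>x. ghat k * echar (rvec k) x * echar (rvec l) x) = (if k = - l then ghat (- l) else 0)" for k
    proof -
      have "(\<lambda>x. ghat k * echar (rvec k) x * echar (rvec l) x) = (\<lambda>x. ghat k * echar (rvec (k + l)) x)"
        by (simp add: rvec_add echar_add_left mult.assoc)
      moreover have "k + l = 0 \<longleftrightarrow> k = - l" by (rule eq_neg_iff_add_eq_0[symmetric])
      ultimately show ?thesis by (simp add: integral_echar_cube)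
    qed
    ultimately have "((\<lambda>k. if k = - l then ghat (- l) else 0) has_sum integral ?Q (\<lambda>x. G x * echar (rvec l) x)) UNIV"
      by simp
    moreover have "((\<lambda>k. if k = - l then ghat (- l) else 0) has_sum ghat (- l)) UNIV"
      using has_sum_finite_neutralI[of "{- l}" UNIV "\<lambda>k. if k = - l then ghat (- l) else 0"] by simp
    ultimately show ?thesis by (rule has_sum_unique)
  qed
  have "F 0 - G 0 = 0"
  proof (rule vanishing_fourier_coeffs_imp_zero)
    show "continuous_on ?Q (\<lambda>x. F x - G x)" by (intro continuous_intros contF contG)
    have "integral ?Q (\<lambda>x. (F x - G x) * echar (rvec k) x)
        = integral ?Q (\<lambda>x. F x * echar (rvec k) x) - integral ?Q (\<lambda>x. G x * echar (rvec k) x)" for k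
      unfolding left_diff_distrib
      by (intro integral_diff integrable_on_centered_cube continuous_intros contF contG)
    then show "integral ?Q (\<lambda>x. (F x - G x) * echar (rvec k) x) = 0" for k
      by (simp add: coeffF coeffG)
  qed
  then show ?thesis by (simp add: F_def G_def)
qed

section \<open>Finite Fourier analysis on the torus\<close>

lemma lattice_box_eq: "lattice_box L = {k::int^'d. \<forall>i. k$i \<in> {0..<int L}}"
  by (auto simp: lattice_box_def)

lemma finite_lattice_box [simp]: "finite (lattice_box L :: (int^'d) set)"
  unfolding lattice_box_eq by (rule finite_vec_box) simp

lemma zero_in_lattice_box: "L \<ge> 1 \<Longrightarrow> 0 \<in> lattice_box L"
  by (simp add: lattice_box_def)

text \<open>Division with remainder in each coordinate of z - v: the remainder is \<open>y\<close>,
  the negated quotient is \<open>m\<close>.\<close>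

lemma bij_betw_lattice_split:
  fixes z :: "int^'d"
  assumes L: "L \<ge> 1"
  shows "bij_betw (\<lambda>(y,m). z - y + (\<chi> i. int L * m$i)) (lattice_box L \<times> UNIV) UNIV"
proof (rule bij_betwI)
  let ?g = "\<lambda>v::int^'d. ((\<chi> i. (z$i - v$i) mod int L), (\<chi> i. - ((z$i - v$i) div int L)))"
  show "?g \<in> UNIV \<rightarrow> lattice_box L \<times> UNIV" using L by (auto simp: lattice_box_def)
  show "?g (case p of (y, m) \<Rightarrow> z - y + (\<chi> i. int L * m$i)) = p" if "p \<in> lattice_box L \<times> UNIV" for p
  proof -
    from that obtain y m where p: "p = (y, m)" "y \<in> lattice_box L" by auto
    have "(y$i - int L * m$i) mod int L = y$i" "(y$i - int L * m$i) div int L = - m$i" for i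
      using p(2) L by (auto simp: lattice_box_def mod_diff_eq[symmetric] intro!: int_div_pos_eq int_mod_pos_eq)
    then show ?thesis by (simp add: p vec_eq_iff)
  qed
  show "(case ?g v of (y, m) \<Rightarrow> z - y + (\<chi> i. int L * m$i)) = v" if "v \<in> UNIV" for v
  proof -
    have "z$i - (z$i - v$i) mod int L - int L * ((z$i - v$i) div int L) = v$i" for i
      using mod_mult_div_eq[of "z$i - v$i" "int L"] by linarith
    then show ?thesis by (simp add: vec_eq_iff)
  qed
qed auto

text \<open>Unfolds the periodization in \<open>sigma2\<close>; applied to \<open>f\<close> it
  yields the row sums, applied to \<open>f\<close> times a character it yields the
  eigenvalues.\<close>

lemma sum_infsum_lattice_split:
  fixes \<phi> :: "int^'d \<Rightarrow> 'b::banach"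
  assumes L: "L \<ge> 1" and \<phi>: "\<phi> summable_on UNIV"
  shows "(\<Sum>y\<in>lattice_box L. \<Sum>\<^sub>\<infinity>m. \<phi> (z - y + (\<chi> i. int L * m$i))) = (\<Sum>\<^sub>\<infinity>v. \<phi> v)"
proof -
  let ?h = "\<lambda>(y,m). z - y + (\<chi> i. int L * m$i)"
  note bij = bij_betw_lattice_split[OF L, of z]
  have "(\<lambda>p. \<phi> (?h p)) summable_on (lattice_box L \<times> UNIV)"
    using summable_on_reindex_bij_betw[OF bij, of \<phi>] \<phi> by simp
  then have summ: "(\<lambda>(y,m). \<phi> (z - y + (\<chi> i. int L * m$i))) summable_on (lattice_box L \<times> UNIV)"
    by (simp add: case_prod_unfold)
  have "(\<Sum>y\<in>lattice_box L. \<Sum>\<^sub>\<infinity>m. \<phi> (z - y + (\<chi> i. int L * m$i)))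
      = (\<Sum>\<^sub>\<infinity>(y,m)\<in>lattice_box L \<times> UNIV. \<phi> (z - y + (\<chi> i. int L * m$i)))"
    using infsum_Sigma'_banach[OF summ] by simp
  also have "\<dots> = (\<Sum>\<^sub>\<infinity>v. \<phi> v)"
    using infsum_reindex_bij_betw[OF bij, of \<phi>] by (simp add: case_prod_unfold)
  finally show ?thesis .
qed

text \<open>A geometric sum with ratio exp (2 pi i z / L). The bound |z| < L keeps this ratio
  different from 1 unless z = 0.\<close>

lemma sum_roots_of_unity:
  fixes z :: int
  assumes L: "L \<ge> 1" and z: "\<bar>z\<bar> < int L"
  shows "(\<Sum>j\<in>{0..<int L}. cis (2 * pi * (real_of_int j * real_of_int z / real L))) = (if z = 0 then of_nat L else 0)"
proof -
  define \<omega> where "\<omega> = cis (2 * pi * (real_of_int z / real L))"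
  have pow: "\<omega> ^ j = cis (2 * pi * (real j * real_of_int z / real L))" for j
    unfolding \<omega>_def Complex.DeMoivre by (simp add: mult_ac)
  have "(\<Sum>j\<in>{0..<int L}. cis (2 * pi * (real_of_int j * real_of_int z / real L))) = (\<Sum>j<L. \<omega> ^ j)"
    by (rule sum.reindex_bij_witness[where i = int and j = nat])
       (auto simp: pow)
  moreover have "(\<Sum>j<L. \<omega> ^ j) = 0" if "z \<noteq> 0"
  proof -
    have "\<omega> \<noteq> 1"
    proof
      assume "\<omega> = 1"
      then obtain n :: int where "2 * pi * (real_of_int z / real L) = of_int (2 * n) * pi"
        by (auto simp: \<omega>_def cis_conv_exp exp_eq_1)
      then have "real_of_int z = real_of_int (n * int L)" using L by (simp add: field_simps)
      then have "z = n * int L" by linarith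
      then have "int L \<le> \<bar>z\<bar>" using \<open>z \<noteq> 0\<close> by (intro zdvd_imp_le) auto
      with z show False by simp
    qed
    moreover have "\<omega> ^ L = 1" using L cis_2pi_int[of z] by (simp add: \<omega>_def Complex.DeMoivre)
    ultimately show ?thesis by (simp add: sum_gp_strict)
  qed
  ultimately show ?thesis by (auto simp: \<omega>_def)
qed

lemma echar_scaled_rvec_prod:
  "echar (rvec k /\<^sub>R real L) (rvec z)
    = (\<Prod>i\<in>UNIV. cis (2 * pi * (real_of_int (k$i) * real_of_int (z$i) / real L)))"
proof -
  have "2 * pi * ((rvec k /\<^sub>R real L) \<bullet> rvec z)
      = (\<Sum>i\<in>UNIV. 2 * pi * (real_of_int (k$i) * real_of_int (z$i) / real L))"
    by (simp add: inner_vec_def sum_distrib_left divide_inverse mult_ac)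
  then show ?thesis by (simp add: echar_def cis_conv_exp exp_sum sum_distrib_left)
qed

lemma sum_box_echar:
  fixes z :: "int^'d"
  assumes L: "L \<ge> 1" and z: "\<And>i. \<bar>z$i\<bar> < int L"
  shows "(\<Sum>k\<in>lattice_box L. echar (rvec k /\<^sub>R real L) (rvec z)) = (if z = 0 then of_nat L ^ CARD('d) else 0)"
proof -
  have "(\<Sum>k\<in>lattice_box L. echar (rvec k /\<^sub>R real L) (rvec z))
      = (\<Prod>i\<in>UNIV. \<Sum>j\<in>{0..<int L}. cis (2 * pi * (real_of_int j * real_of_int (z$i) / real L)))"
    unfolding echar_scaled_rvec_prod lattice_box_eq
    by (rule sum_vec_box_prod[where g = "\<lambda>i j. cis (2 * pi * (real_of_int j * real_of_int (z$i) / real L))"]) simp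
  also have "\<dots> = (\<Prod>i\<in>(UNIV::'d set). if z$i = 0 then of_nat L else 0)"
    by (intro prod.cong refl sum_roots_of_unity L z)
  also have "\<dots> = (if z = 0 then of_nat L ^ CARD('d) else 0)"
    by (auto simp: vec_eq_iff intro!: prod_zero)
  finally show ?thesis .
qed

lemma echar_lattice_period:
  assumes "L \<ge> 1"
  shows "echar (rvec k /\<^sub>R real L) (rvec (\<chi> i. int L * m$i)) = 1"
proof -
  have "(rvec k /\<^sub>R real L) \<bullet> rvec (\<chi> i. int L * m$i) = rvec k \<bullet> rvec m"
    using assms by (auto simp: inner_vec_def intro!: sum.cong)
  then have "echar (rvec k /\<^sub>R real L) (rvec (\<chi> i. int L * m$i)) = echar (rvec k) (rvec m)"
    by (simp add: echar_def)
  then show ?thesis by simp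
qed

section \<open>Scaling and elementary decay estimates\<close>

lemma lborel_integral_scaleR:
  fixes h :: "'a::euclidean_space \<Rightarrow> 'b::euclidean_space"
  assumes h: "integrable lborel h" and W: "W > 0"
  shows "integrable lborel (\<lambda>u. h (u /\<^sub>R W))"
    and "(\<integral>u. h (u /\<^sub>R W) \<partial>lborel) = W ^ DIM('a) *\<^sub>R (\<integral>u. h u \<partial>lborel)"
proof -
  have [measurable]: "h \<in> borel_measurable borel" using h by auto
  have eq: "lborel = density (distr lborel borel (\<lambda>x::'a. 0 + (1 / W) *\<^sub>R x)) (\<lambda>_. \<bar>1 / W\<bar> ^ DIM('a))"
    using W by (intro lborel_affine) auto
  have "integrable (density (distr lborel borel (\<lambda>x::'a. 0 + (1 / W) *\<^sub>R x)) (\<lambda>_. \<bar>1 / W\<bar> ^ DIM('a))) h"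
    using h by (subst eq[symmetric])
  then have "integrable lborel (\<lambda>u. (1 / W) ^ DIM('a) *\<^sub>R h (u /\<^sub>R W))"
    using W by (simp add: integrable_density integrable_distr_eq divide_inverse)
  from integrable_scaleR_right[OF this, of "W ^ DIM('a)"]
  show "integrable lborel (\<lambda>u. h (u /\<^sub>R W))"
    using W by (simp add: power_divide)
  have "(\<integral>u. h u \<partial>lborel) = (\<integral>u. h u \<partial>density (distr lborel borel (\<lambda>x::'a. 0 + (1 / W) *\<^sub>R x)) (\<lambda>_. \<bar>1 / W\<bar> ^ DIM('a)))"
    by (subst eq) (rule refl)
  also have "\<dots> = (1 / W) ^ DIM('a) *\<^sub>R (\<integral>u. h (u /\<^sub>R W) \<partial>lborel)"
    using W by (simp add: integral_density integral_distr divide_inverse)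
  finally show "(\<integral>u. h (u /\<^sub>R W) \<partial>lborel) = W ^ DIM('a) *\<^sub>R (\<integral>u. h u \<partial>lborel)"
    using W by (simp add: power_divide)
qed

text \<open>This is \<open>y <= exp y\<close> at \<open>y = u * c / s\<close>, raised to the power
  \<open>s\<close>.\<close>

lemma powr_exp_bound:
  fixes c s u :: real
  assumes "c > 0" "s > 0" "u \<ge> 0"
  shows "u powr s \<le> (s / c) powr s * exp (c * u)"
proof -
  have "u * c / s \<le> exp (u * c / s)" using exp_ge_add_one_self[of "u * c / s"] by linarith
  then have "(u * c / s) powr s \<le> exp (u * c / s) powr s" using assms by (intro powr_mono2) auto
  also have "\<dots> = exp (c * u)" using assms by (simp add: powr_def mult.commute)
  finally have "(s / c) powr s * (u * c / s) powr s \<le> (s / c) powr s * exp (c * u)"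
    by (intro mult_left_mono) auto
  moreover have "(s / c) powr s * (u * c / s) powr s = u powr s"
    using assms by (subst powr_mult[symmetric]) auto
  ultimately show ?thesis by simp
qed

text \<open>Trades the stretched exponential for a K-th power, so that low frequencies are covered
  by the same lattice sum as the tail.\<close>

lemma exp_powr_decay:
  fixes c K \<alpha> :: real
  assumes "c > 0" "K > 0" "\<alpha> > 0"
  shows "\<exists>C>0. \<forall>t\<ge>0. exp (- c * t powr \<alpha>) \<le> C * (1 + t) powr (- K)"
proof -
  define D where "D = (K / \<alpha> / c) powr (K / \<alpha>)"
  have "exp (- c * t powr \<alpha>) \<le> 2 powr K * (1 + D) * (1 + t) powr (- K)" if t: "t \<ge> 0" for t
  proof -
    have "t powr K \<le> D * exp (c * t powr \<alpha>)"
      using powr_exp_bound[of c "K / \<alpha>" "t powr \<alpha>"] assms by (simp add: D_def powr_powr)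
    moreover have "(1 + t) powr K \<le> 2 powr K * (1 + t powr K)"
    proof (cases "t \<le> 1")
      case True
      then have "(1 + t) powr K \<le> 2 powr K * 1" using t assms by (simp add: powr_mono2)
      also have "\<dots> \<le> 2 powr K * (1 + t powr K)" by (intro mult_left_mono) auto
      finally show ?thesis .
    next
      case False
      then have "(1 + t) powr K \<le> (2 * t) powr K" using assms by (intro powr_mono2) auto
      also have "\<dots> = 2 powr K * t powr K" using t by (simp add: powr_mult)
      also have "\<dots> \<le> 2 powr K * (1 + t powr K)" by (intro mult_left_mono) auto
      finally show ?thesis .
    qed
    moreover have "1 \<le> exp (c * t powr \<alpha>)" using assms by (subst one_le_exp_iff) simp
    ultimately have le: "(1 + t) powr K \<le> 2 powr K * (1 + t powr K)" "1 + t powr K \<le> (1 + D) * exp (c * t powr \<alpha>)"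
      unfolding distrib_right by linarith+
    have "(1 + t) powr K \<le> 2 powr K * ((1 + D) * exp (c * t powr \<alpha>))"
      by (rule order_trans[OF le(1) mult_left_mono[OF le(2)]]) simp
    then have "(1 + t) powr K * exp (- c * t powr \<alpha>) \<le> 2 powr K * (1 + D)"
      by (simp add: exp_minus field_simps)
    then show ?thesis using t by (simp add: powr_minus field_simps)
  qed
  moreover have "2 powr K * (1 + D) > 0" by (simp add: D_def add_pos_nonneg)
  ultimately show ?thesis by blast
qed

text \<open>The exponent is n - 1 because one factor of the Fourier transform is reserved for
  summability over frequencies; the lost factor is paid by 1 / \<rho> in the constant.\<close>

lemma power_le_powr_decay:
  fixes \<rho> s :: real
  assumes "0 < \<rho>" "\<rho> < 1" "s > 0"
  shows "\<exists>C>0. \<forall>n\<ge>1. \<rho> ^ (n - 1) \<le> C * real n powr (- s)"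
proof -
  define c where "c = - ln \<rho>"
  have c: "c > 0" using assms by (simp add: c_def)
  define D where "D = (s / c) powr s / \<rho>"
  have "\<rho> ^ (n - 1) \<le> D * real n powr (- s)" if n: "n \<ge> 1" for n
  proof -
    have "exp (c * real n) = inverse (\<rho> ^ n)"
      using assms by (simp add: c_def exp_minus mult.commute exp_of_nat_mult)
    then have "real n powr s \<le> (s / c) powr s * inverse (\<rho> ^ n)"
      using powr_exp_bound[OF c assms(3), of "real n"] by simp
    then have "real n powr s * \<rho> ^ n \<le> (s / c) powr s" using assms by (simp add: field_simps)
    moreover have "\<rho> ^ n = \<rho> * \<rho> ^ (n - 1)" using n by (cases n) auto
    ultimately show ?thesis using assms n by (simp add: D_def powr_minus field_simps)
  qed
  moreover have "D > 0" using assms c by (simp add: D_def)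
  ultimately show ?thesis by blast
qed

section \<open>The profile and its lattice sums\<close>

text \<open>Positivity, mass, continuity and decay are fixed here. The bounds on the transform near
  and far from 0 enter later, where its powers are summed.\<close>

locale band_profile =
  fixes f :: "real^'d \<Rightarrow> real" and T CT K CK :: real
  assumes nonneg: "0 \<le> f u"
    and int1: "(f has_integral 1) UNIV"
    and cont: "continuous_on UNIV f"
    and T: "T > real CARD('d)" and K: "K > real CARD('d)"
    and CT: "CT > 1" and CK: "CK > 1"
    and decay: "f u \<le> CT * (1 + norm u) powr (- T)"
    and decay_fourier: "norm (fourier f \<xi>) \<le> CK * (1 + norm \<xi>) powr (- K)"
begin

lemma K_pos: "K > 0" and T_pos: "T > 0"
  using K T by (smt (verit) of_nat_0_le_iff)+

lemma fourier_eq: "fourier f \<xi> = integral UNIV (\<lambda>u. of_real (f u) * echar (- \<xi>) u)"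
  by (simp add: fourier_def echar_def)

lemma f_borel [measurable]: "f \<in> borel_measurable borel"
  using cont by (rule borel_measurable_continuous_onI)

lemma f_integrable: "integrable lborel f"
proof -
  have "f absolutely_integrable_on UNIV"
    using int1 nonneg by (intro nonnegative_absolutely_integrable_1) auto
  then have "integrable lebesgue f" by (simp add: set_integrable_def)
  then show ?thesis by (subst (asm) integrable_completion) auto
qed

lemma f_echar_integrable: "integrable lborel (\<lambda>u. complex_of_real (f u) * echar \<xi> u)"
  by (rule Bochner_Integration.integrable_bound[OF f_integrable]) (auto simp: norm_mult)

lemma norm_fourier_le_1: "norm (fourier f \<xi>) \<le> 1"
proof -
  have "norm (\<integral>u. complex_of_real (f u) * echar (- \<xi>) u \<partial>lborel) \<le> (\<integral>u. f u \<partial>lborel)"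
    by (rule Bochner_Integration.integral_norm_bound_integral[OF f_echar_integrable f_integrable])
       (auto simp: norm_mult nonneg)
  then show ?thesis
    using integral_lborel[OF f_echar_integrable] integral_lborel[OF f_integrable] integral_unique[OF int1]
    by (simp add: fourier_eq)
qed

lemma fourier_0: "fourier f 0 = 1"
proof -
  have "((\<lambda>u. complex_of_real (f u)) has_integral complex_of_real 1) UNIV"
    using has_integral_linear[OF int1 bounded_linear_of_real[where 'a = complex]] by (simp add: o_def)
  then show ?thesis by (simp add: fourier_eq integral_unique)
qed

lemma f_shift_bound:
  assumes W: "W > 0"
  shows "f ((x + rvec m) /\<^sub>R W) \<le> CT * (1 + norm x / W) powr T * (1 + (1 / W) * norm (rvec m)) powr (- T)"
proof -
  have "f ((x + rvec m) /\<^sub>R W) \<le> CT * (1 + norm (x /\<^sub>R W + rvec m /\<^sub>R W)) powr (- T)"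
    using decay[of "(x + rvec m) /\<^sub>R W"] by (simp add: scaleR_add_right)
  also have "\<dots> \<le> CT * ((1 + norm (x /\<^sub>R W)) powr T * (1 + norm (rvec m /\<^sub>R W)) powr (- T))"
    using CT T_pos by (intro mult_left_mono powr_shift_le) auto
  finally show ?thesis using W by (simp add: divide_inverse mult_ac)
qed

lemma f_lattice_summable:
  assumes W: "W > 0"
  shows "(\<lambda>m::int^'d. f (rvec m /\<^sub>R W)) summable_on UNIV"
proof (rule summable_on_comparison_test)
  show "(\<lambda>m::int^'d. CT * (1 + (1 / W) * norm (rvec m)) powr (- T)) summable_on UNIV"
    using W T by (intro summable_on_cmult_right summable_lattice_powr) auto
  show "f (rvec m /\<^sub>R W) \<le> CT * (1 + (1 / W) * norm (rvec m)) powr (- T)" for m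
    using f_shift_bound[OF W, of 0 m] by simp
qed (rule nonneg)

lemma fourier_shift_bound:
  assumes W: "W > 0"
  shows "norm (fourier f (W *\<^sub>R (rvec m + \<theta>))) \<le> CK * (1 + W * norm \<theta>) powr K * (1 + W * norm (rvec m)) powr (- K)"
proof -
  have "norm (fourier f (W *\<^sub>R (rvec m + \<theta>))) \<le> CK * (1 + norm (W *\<^sub>R \<theta> + W *\<^sub>R rvec m)) powr (- K)"
    using decay_fourier[of "W *\<^sub>R (rvec m + \<theta>)"] by (simp add: scaleR_add_right add.commute)
  also have "\<dots> \<le> CK * ((1 + norm (W *\<^sub>R \<theta>)) powr K * (1 + norm (W *\<^sub>R rvec m)) powr (- K))"
    using CK K_pos by (intro mult_left_mono powr_shift_le) auto
  finally show ?thesis using W by (simp add: mult_ac)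
qed

lemma fourier_lattice_abs_summable:
  assumes W: "W > 0"
  shows "(\<lambda>m::int^'d. norm (fourier f (W *\<^sub>R (rvec m + \<theta>)))) summable_on UNIV"
proof (rule summable_on_comparison_test)
  show "(\<lambda>m::int^'d. CK * (1 + W * norm \<theta>) powr K * (1 + W * norm (rvec m)) powr (- K)) summable_on UNIV"
    using W K by (intro summable_on_cmult_right summable_lattice_powr) auto
qed (use fourier_shift_bound[OF W] in auto)

text \<open>Poisson summation for f(u / W) times the character of frequency -\<theta>. The
  substitution u = W w turns its Fourier coefficient at k into W^d fhat (W (k + \<theta>)).\<close>

lemma lattice_sum_eq_fourier_sum:
  assumes W: "W > 0"
  shows "(\<Sum>\<^sub>\<infinity>v. of_real (f (rvec v /\<^sub>R W)) * echar \<theta> (rvec (- v)))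
    = of_real (W ^ CARD('d)) * (\<Sum>\<^sub>\<infinity>m. fourier f (W *\<^sub>R (rvec m + \<theta>)))"
proof -
  define g where "g u = of_real (f (u /\<^sub>R W)) * echar (- \<theta>) u" for u
  have uminus: "rvec (- v) = - rvec v" for v :: "int^'d" by (simp add: vec_eq_iff)
  have g_scaled: "g u * echar (rvec (- k)) u = (\<lambda>w. complex_of_real (f w) * echar (- (W *\<^sub>R (rvec k + \<theta>))) w) (u /\<^sub>R W)" for u k
  proof -
    have "echar (- \<theta>) u * echar (rvec (- k)) u = echar (- (W *\<^sub>R (rvec k + \<theta>))) (u /\<^sub>R W)"
      unfolding echar_def cis_mult using W
      by (intro arg_cong[where f = cis]) (simp add: uminus inner_add_left inner_diff_left field_simps)
    then show ?thesis by (simp add: g_def mult.assoc)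
  qed
  have g_int: "integrable lborel (\<lambda>u. g u * echar (rvec (- k)) u)" for k
    unfolding g_scaled by (rule lborel_integral_scaleR(1)[OF f_echar_integrable W])
  have "(\<Sum>\<^sub>\<infinity>m. g (rvec m)) = (\<Sum>\<^sub>\<infinity>k. of_real (W ^ CARD('d)) * fourier f (W *\<^sub>R (rvec k + \<theta>)))"
  proof (rule poisson_summation)
    show "continuous_on UNIV g"
      unfolding g_def using W by (intro continuous_intros continuous_on_compose2[OF cont]) auto
    show "integrable lborel g" using g_int[of 0] by simp
    show "norm (g (x + rvec m)) \<le> CT * (1 + real CARD('d) / W) powr T * (1 + (1 / W) * norm (rvec m)) powr (- T)"
      if "x \<in> centered_cube" for m x
    proof -
      have "norm (g (x + rvec m)) = f ((x + rvec m) /\<^sub>R W)" using nonneg by (simp add: g_def norm_mult)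
      also have "\<dots> \<le> CT * (1 + norm x / W) powr T * (1 + (1 / W) * norm (rvec m)) powr (- T)"
        by (rule f_shift_bound[OF W])
      also have "\<dots> \<le> CT * (1 + real CARD('d) / W) powr T * (1 + (1 / W) * norm (rvec m)) powr (- T)"
        using CT W T_pos norm_le_on_centered_cube[OF that]
        by (intro mult_right_mono mult_left_mono powr_mono2 add_left_mono divide_right_mono) auto
      finally show ?thesis .
    qed
    show "(\<lambda>m::int^'d. CT * (1 + real CARD('d) / W) powr T * (1 + (1 / W) * norm (rvec m)) powr (- T)) summable_on UNIV"
      using W T by (intro summable_on_cmult_right summable_lattice_powr) auto
    show "of_real (W ^ CARD('d)) * fourier f (W *\<^sub>R (rvec k + \<theta>)) = integral UNIV (\<lambda>u. g u * echar (rvec (- k)) u)" for k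
    proof -
      have "integral UNIV (\<lambda>u. g u * echar (rvec (- k)) u) = (\<integral>u. g u * echar (rvec (- k)) u \<partial>lborel)"
        by (rule integral_lborel[OF g_int])
      also have "\<dots> = W ^ CARD('d) *\<^sub>R (\<integral>w. of_real (f w) * echar (- (W *\<^sub>R (rvec k + \<theta>))) w \<partial>lborel)"
        unfolding g_scaled by (subst lborel_integral_scaleR(2)[OF f_echar_integrable W]) simp
      also have "\<dots> = of_real (W ^ CARD('d)) * fourier f (W *\<^sub>R (rvec k + \<theta>))"
        by (simp add: fourier_eq integral_lborel[OF f_echar_integrable] scaleR_conv_of_real)
      finally show ?thesis by simp
    qed
    show "(\<lambda>k. norm (of_real (W ^ CARD('d)) * fourier f (W *\<^sub>R (rvec k + \<theta>)))) summable_on UNIV"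
      unfolding norm_mult by (intro summable_on_cmult_right fourier_lattice_abs_summable W)
  qed
  moreover have "g (rvec v) = of_real (f (rvec v /\<^sub>R W)) * echar \<theta> (rvec (- v))" for v
    by (simp add: g_def uminus echar_def)
  ultimately show ?thesis by (simp add: infsum_cmult_right')
qed

text \<open>On the centred cube |m| <= 2 |m + \<theta>| holds coordinatewise. With |m| >= 1 for
  nonzero m this gives (1 + |m|) / 4 <= |m + \<theta>|, so each remaining term carries W^-K and,
  because K > d, their sum converges.\<close>

lemma fourier_lattice_tail:
  "\<exists>D>0. \<forall>W>0. \<forall>\<theta>\<in>centered_cube.
     norm ((\<Sum>\<^sub>\<infinity>m. fourier f (W *\<^sub>R (rvec m + \<theta>))) - fourier f (W *\<^sub>R \<theta>)) \<le> D * W powr (- K)"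
proof -
  define Z where "Z = (\<Sum>\<^sub>\<infinity>m\<in>-{0::int^'d}. (1 + 1 * norm (rvec m)) powr (- K))"
  have Zs: "(\<lambda>m::int^'d. (1 + 1 * norm (rvec m)) powr (- K)) summable_on -{0}"
    using summable_lattice_powr[OF zero_less_one K] by (rule summable_on_subset_banach) auto
  have Z: "Z \<ge> 0" unfolding Z_def by (rule infsum_nonneg) auto
  \<comment> \<open>\<open>Z\<close> is only shown to be nonnegative; the summand 1 makes
    \<open>D\<close> positive.\<close>
  define D where "D = CK * 4 powr K * Z + 1"
  have D: "D > 0" using Z CK by (simp add: D_def add_nonneg_pos)
  have "norm ((\<Sum>\<^sub>\<infinity>m. fourier f (W *\<^sub>R (rvec m + \<theta>))) - fourier f (W *\<^sub>R \<theta>)) \<le> D * W powr (- K)"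
    if W: "W > 0" and \<theta>: "\<theta> \<in> centered_cube" for W \<theta>
  proof -
    let ?F = "\<lambda>m::int^'d. fourier f (W *\<^sub>R (rvec m + \<theta>))"
    have abs: "(\<lambda>m. norm (?F m)) summable_on A" for A
      using fourier_lattice_abs_summable[OF W] by (rule summable_on_subset_banach) auto
    have "(\<Sum>\<^sub>\<infinity>m. ?F m) = (\<Sum>\<^sub>\<infinity>m\<in>insert 0 (-{0}). ?F m)"
      by (rule arg_cong[where f = "infsum ?F"]) auto
    also have "\<dots> = ?F 0 + (\<Sum>\<^sub>\<infinity>m\<in>-{0}. ?F m)"
      by (rule infsum_insert[OF abs_summable_summable[OF abs]]) simp
    finally have "norm ((\<Sum>\<^sub>\<infinity>m. ?F m) - fourier f (W *\<^sub>R \<theta>)) = norm (\<Sum>\<^sub>\<infinity>m\<in>-{0}. ?F m)" by simp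
    also have "\<dots> \<le> (\<Sum>\<^sub>\<infinity>m\<in>-{0}. norm (?F m))" by (rule norm_infsum_bound[OF abs])
    also have "\<dots> \<le> (\<Sum>\<^sub>\<infinity>m\<in>-{0::int^'d}. CK * 4 powr K * W powr (- K) * (1 + 1 * norm (rvec m)) powr (- K))"
    proof (rule infsum_mono)
      show "(\<lambda>m::int^'d. CK * 4 powr K * W powr (- K) * (1 + 1 * norm (rvec m)) powr (- K)) summable_on -{0}"
        by (intro summable_on_cmult_right Zs)
      fix m :: "int^'d" assume m: "m \<in> -{0}"
      have "norm (rvec m) \<le> norm (2 *\<^sub>R (rvec m + \<theta>))"
      proof (rule norm_le_componentwise_cart)
        fix i
        have \<theta>i: "\<bar>\<theta>$i\<bar> \<le> 1/2" using \<theta> unfolding mem_centered_cube by blast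
        have "m$i = 0 \<or> 1 \<le> \<bar>real_of_int (m$i)\<bar>" by linarith
        then have "\<bar>real_of_int (m$i)\<bar> \<le> \<bar>2 * real_of_int (m$i) + 2 * \<theta>$i\<bar>"
        proof
          have aux: "\<bar>t\<bar> \<le> 1/2 \<Longrightarrow> 1 \<le> \<bar>a\<bar> \<Longrightarrow> \<bar>a\<bar> \<le> \<bar>2 * a + 2 * t\<bar>" for a t :: real
            by (auto simp: abs_if split: if_splits)
          assume "1 \<le> \<bar>real_of_int (m$i)\<bar>"
          with \<theta>i show ?thesis by (rule aux)
        qed simp
        then show "norm (rvec m $ i) \<le> norm ((2 *\<^sub>R (rvec m + \<theta>)) $ i)" by (simp add: abs_mult)
      qed
      then have "(1 + norm (rvec m)) / 4 \<le> norm (rvec m + \<theta>)"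
        using norm_rvec_ge_1[of m] m by simp
      then have "W * ((1 + norm (rvec m)) / 4) \<le> W * norm (rvec m + \<theta>)" using W by (intro mult_left_mono) auto
      also have "\<dots> \<le> 1 + norm (W *\<^sub>R (rvec m + \<theta>))" using W by simp
      finally have "(1 + norm (W *\<^sub>R (rvec m + \<theta>))) powr (- K) \<le> (W * ((1 + norm (rvec m)) / 4)) powr (- K)"
        using W K_pos by (intro powr_mono2') (auto simp: add_pos_nonneg)
      also have "\<dots> = 4 powr K * W powr (- K) * (1 + norm (rvec m)) powr (- K)"
        unfolding powr_mult powr_divide using W by (simp add: powr_minus divide_simps)
      finally have "CK * (1 + norm (W *\<^sub>R (rvec m + \<theta>))) powr (- K) \<le> CK * (4 powr K * W powr (- K) * (1 + norm (rvec m)) powr (- K))"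
        using CK by (intro mult_left_mono) auto
      then show "norm (?F m) \<le> CK * 4 powr K * W powr (- K) * (1 + 1 * norm (rvec m)) powr (- K)"
        using decay_fourier[of "W *\<^sub>R (rvec m + \<theta>)"] by (simp add: mult_ac)
    qed (rule abs)
    also have "\<dots> = CK * 4 powr K * Z * W powr (- K)"
      by (simp add: Z_def infsum_cmult_right' mult_ac)
    also have "\<dots> \<le> D * W powr (- K)" unfolding D_def by (intro mult_right_mono) auto
    finally show ?thesis .
  qed
  with D show ?thesis by blast
qed

section \<open>The symbol of the transition matrix\<close>

text \<open>At frequencies k/L this is the eigenvalue of the transition matrix on the corresponding
  character. It takes the value 0 if the normalization vanishes.\<close>

definition symb :: "real \<Rightarrow> real^'d \<Rightarrow> complex" where
  "symb W \<theta> = (\<Sum>\<^sub>\<infinity>v. of_real (f (rvec v /\<^sub>R W)) * echar \<theta> (rvec (- v))) / of_real (band_norm f W)"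

lemma band_norm_nonneg: "band_norm f W \<ge> 0"
  unfolding band_norm_def by (intro infsum_nonneg nonneg)

lemma symb_abs_summable:
  assumes "W > 0"
  shows "(\<lambda>v. norm (of_real (f (rvec v /\<^sub>R W)) * echar \<theta> (rvec (- v)))) summable_on UNIV"
  using f_lattice_summable[OF assms] by (simp add: norm_mult nonneg)

lemma norm_symb_le_1:
  assumes "W > 0"
  shows "norm (symb W \<theta>) \<le> 1"
proof -
  have "norm (\<Sum>\<^sub>\<infinity>v. of_real (f (rvec v /\<^sub>R W)) * echar \<theta> (rvec (- v))) \<le> band_norm f W"
    using norm_infsum_bound[OF symb_abs_summable[OF assms, of \<theta>]] by (simp add: norm_mult nonneg band_norm_def)
  then show ?thesis using band_norm_nonneg[of W] by (auto simp: symb_def norm_divide divide_le_eq_1)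
qed

lemma symb_periodic: "symb W (\<theta> + rvec j) = symb W \<theta>"
  by (simp add: symb_def echar_add_left)

lemma of_real_band_norm:
  assumes W: "W > 0"
  shows "of_real (band_norm f W) = of_real (W ^ CARD('d)) * (\<Sum>\<^sub>\<infinity>m. fourier f (W *\<^sub>R rvec m))"
proof -
  have "((\<lambda>m. complex_of_real (f (rvec m /\<^sub>R W))) has_sum complex_of_real (band_norm f W)) UNIV"
    unfolding band_norm_def by (intro has_sum_of_real has_sum_infsum f_lattice_summable W)
  then have "of_real (band_norm f W) = (\<Sum>\<^sub>\<infinity>v. complex_of_real (f (rvec v /\<^sub>R W)))"
    by (rule infsumI[symmetric])
  then show ?thesis using lattice_sum_eq_fourier_sum[OF W, of 0] by simp
qed

text \<open>Let B and A be the sums of fhat at frequencies \<theta> and 0, and h the main term of B.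
  Then B / A - h = ((B - h) - h (A - 1)) / A, where both differences are O(W^-K) and |h| <= 1. With
  |A| >= 1/2 the constant becomes 4 times that of the tail.\<close>

lemma symb_approx:
  "\<exists>D>0. \<exists>W0>0. \<forall>W\<ge>W0. band_norm f W > 0 \<and>
     (\<forall>\<theta>\<in>centered_cube. norm (symb W \<theta> - fourier f (W *\<^sub>R \<theta>)) \<le> D * W powr (- K))"
proof -
  obtain D where D: "D > 0" and tail: "\<And>W \<theta>. W > 0 \<Longrightarrow> \<theta> \<in> centered_cube \<Longrightarrow>
     norm ((\<Sum>\<^sub>\<infinity>m. fourier f (W *\<^sub>R (rvec m + \<theta>))) - fourier f (W *\<^sub>R \<theta>)) \<le> D * W powr (- K)"
    using fourier_lattice_tail by blast
  \<comment> \<open>Chosen so that D W0^-K = 1/2, which keeps A within 1/2 of 1.\<close>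
  define W0 where "W0 = (2 * D) powr (1 / K)"
  have W0: "W0 > 0" using D by (simp add: W0_def)
  have "band_norm f W > 0 \<and> (\<forall>\<theta>\<in>centered_cube. norm (symb W \<theta> - fourier f (W *\<^sub>R \<theta>)) \<le> 4 * D * W powr (- K))"
    if "W \<ge> W0" for W
  proof -
    have W: "W > 0" using that W0 by simp
    define A where "A = (\<Sum>\<^sub>\<infinity>m. fourier f (W *\<^sub>R rvec m))"
    have M: "of_real (band_norm f W) = of_real (W ^ CARD('d)) * A"
      unfolding A_def by (rule of_real_band_norm[OF W])
    have A1: "norm (A - 1) \<le> D * W powr (- K)"
      using tail[OF W, of 0] by (simp add: mem_centered_cube A_def fourier_0)
    have "W powr (- K) \<le> W0 powr (- K)" using that W0 K_pos by (intro powr_mono2') auto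
    also have "\<dots> = (2 * D) powr (- 1)" using K_pos by (simp add: W0_def powr_powr)
    also have "\<dots> = 1 / (2 * D)" using D by (simp add: powr_neg_one)
    finally have "D * W powr (- K) \<le> 1/2" using D by (simp add: field_simps)
    then have "norm A \<ge> 1/2" using A1 norm_triangle_ineq2[of 1 "1 - A"] by (simp add: norm_minus_commute)
    then have "A \<noteq> 0" by auto
    have "band_norm f W \<noteq> 0" using M W \<open>A \<noteq> 0\<close> by (metis mult_eq_0_iff of_real_0 of_real_eq_0_iff power_not_zero less_irrefl)
    moreover have "norm (symb W \<theta> - fourier f (W *\<^sub>R \<theta>)) \<le> 4 * D * W powr (- K)" if \<theta>: "\<theta> \<in> centered_cube" for \<theta>
    proof -
      define B where "B = (\<Sum>\<^sub>\<infinity>m. fourier f (W *\<^sub>R (rvec m + \<theta>)))"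
      let ?h = "fourier f (W *\<^sub>R \<theta>)"
      have "symb W \<theta> = B / A"
        unfolding symb_def M lattice_sum_eq_fourier_sum[OF W] B_def[symmetric] using W by simp
      then have "symb W \<theta> - ?h = ((B - ?h) - ?h * (A - 1)) / A"
        using \<open>A \<noteq> 0\<close> by (simp add: field_simps)
      then have "norm (symb W \<theta> - ?h) = norm ((B - ?h) - ?h * (A - 1)) / norm A" by (simp add: norm_divide)
      also have "\<dots> \<le> norm ((B - ?h) - ?h * (A - 1)) / (1/2)"
        using \<open>norm A \<ge> 1/2\<close> by (intro divide_left_mono) auto
      also have "norm ((B - ?h) - ?h * (A - 1)) \<le> norm (B - ?h) + norm ?h * norm (A - 1)"
        by (metis norm_mult norm_triangle_ineq4)
      also have "\<dots> \<le> D * W powr (- K) + 1 * (D * W powr (- K))"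
        using tail[OF W \<theta>] A1 norm_fourier_le_1 by (intro add_mono mult_mono) (auto simp: B_def)
      finally show ?thesis by (simp add: divide_right_mono)
    qed
    ultimately show ?thesis using band_norm_nonneg[of W] by simp
  qed
  then show ?thesis using D W0 by (intro exI[of _ "4 * D"] conjI exI[of _ W0]) auto
qed

section \<open>Transition probabilities and Fourier inversion\<close>

lemma sigma2_nonneg: "sigma2 f W L x y \<ge> 0"
  unfolding sigma2_def using nonneg by (intro divide_nonneg_nonneg infsum_nonneg band_norm_nonneg) auto

lemma trans_prob_nonneg: "trans_prob f W L n x y \<ge> 0"
  by (induction n arbitrary: y) (auto intro!: sum_nonneg mult_nonneg_nonneg sigma2_nonneg)

text \<open>If \<open>band_norm f W = 0\<close>, which can happen for small \<open>W\<close>, then \<open>sigma2\<close>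
  vanishes because of division by zero, so the rows are only substochastic.\<close>
lemma sum_sigma2_le_1:
  assumes "W > 0" "L \<ge> 1"
  shows "(\<Sum>y\<in>lattice_box L. sigma2 f W L z y) \<le> 1"
proof -
  have "(\<Sum>y\<in>lattice_box L. sigma2 f W L z y) = band_norm f W / band_norm f W"
    unfolding sigma2_def sum_divide_distrib[symmetric]
    using sum_infsum_lattice_split[OF assms(2) f_lattice_summable[OF assms(1)], of z] by (simp add: band_norm_def)
  then show ?thesis by (cases "band_norm f W = 0") auto
qed

lemma sum_trans_prob_le_1:
  assumes "W > 0" "L \<ge> 1"
  shows "(\<Sum>y\<in>lattice_box L. trans_prob f W L n x y) \<le> 1"
proof (induction n)
  case 0
  show ?case by (simp add: sum.delta)
next
  case (Suc n)
  have "(\<Sum>y\<in>lattice_box L. trans_prob f W L (Suc n) x y)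
      = (\<Sum>z\<in>lattice_box L. trans_prob f W L n x z * (\<Sum>y\<in>lattice_box L. sigma2 f W L z y))"
    unfolding trans_prob.simps sum_distrib_left by (rule sum.swap)
  also have "\<dots> \<le> (\<Sum>z\<in>lattice_box L. trans_prob f W L n x z * 1)"
    by (intro sum_mono mult_left_mono sum_sigma2_le_1 assms trans_prob_nonneg)
  finally show ?case using Suc by simp
qed

lemma trans_prob_le_1:
  assumes "W > 0" "L \<ge> 1" "y \<in> lattice_box L"
  shows "trans_prob f W L n x y \<le> 1"
proof -
  have "trans_prob f W L n x y \<le> (\<Sum>y\<in>lattice_box L. trans_prob f W L n x y)"
    using assms(3) by (intro member_le_sum trans_prob_nonneg) auto
  then show ?thesis using sum_trans_prob_le_1[OF assms(1,2), of n x] by (rule order_trans)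
qed

text \<open>Characters of frequency k/L have period \<open>L\<close> on the lattice, hence live on
  the torus, where they diagonalize the convolution matrix \<open>sigma2\<close>.\<close>

lemma sum_sigma2_echar:
  assumes W: "W > 0" and L: "L \<ge> 1"
  shows "(\<Sum>y\<in>lattice_box L. of_real (sigma2 f W L z y) * echar (rvec k /\<^sub>R real L) (rvec y))
    = echar (rvec k /\<^sub>R real L) (rvec z) * symb W (rvec k /\<^sub>R real L)"
proof -
  let ?\<theta> = "rvec k /\<^sub>R real L"
  define \<phi> where "\<phi> v = complex_of_real (f (rvec v /\<^sub>R W)) * echar ?\<theta> (rvec (- v))" for v
  have \<phi>: "\<phi> summable_on UNIV"
    using abs_summable_summable[OF symb_abs_summable[OF W, of ?\<theta>]] by (simp add: \<phi>_def[abs_def])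
  have "of_real (sigma2 f W L z y) * echar ?\<theta> (rvec y)
      = echar ?\<theta> (rvec z) * (\<Sum>\<^sub>\<infinity>m. \<phi> (z - y + (\<chi> i. int L * m$i))) / of_real (band_norm f W)" for y
  proof -
    have "inj (\<lambda>m. z - y + (\<chi> i. int L * m$i))" using L by (auto simp: inj_def vec_eq_iff)
    then have summ: "(\<lambda>m. f (rvec (z - y + (\<chi> i. int L * m$i)) /\<^sub>R W)) summable_on UNIV"
      using summable_on_reindex[of "\<lambda>m. z - y + (\<chi> i. int L * m$i)" UNIV "\<lambda>v. f (rvec v /\<^sub>R W)"]
        summable_on_subset_banach[OF f_lattice_summable[OF W], of "range (\<lambda>m. z - y + (\<chi> i. int L * m$i))"]
      by (simp add: o_def)
    have "\<phi> (z - y + (\<chi> i. int L * m$i)) * echar ?\<theta> (rvec z)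
        = of_real (f (rvec (z - y + (\<chi> i. int L * m$i)) /\<^sub>R W)) * echar ?\<theta> (rvec y)" for m
    proof -
      \<comment> \<open>Up to a period, undoing the step z - y from z leads to y; this pulls the
        factor at z out of the sum.\<close>
      have "- (z - y + (\<chi> i. int L * m$i)) + z = y + (\<chi> i. int L * (- m)$i)"
        by (simp add: vec_eq_iff)
      then have "echar ?\<theta> (rvec (- (z - y + (\<chi> i. int L * m$i)))) * echar ?\<theta> (rvec z)
          = echar ?\<theta> (rvec (y + (\<chi> i. int L * (- m)$i)))"
        by (simp only: echar_add_right[symmetric] rvec_add[symmetric])
      also have "\<dots> = echar ?\<theta> (rvec y)"
        by (simp only: rvec_add echar_add_right echar_lattice_period[OF L] mult_1_right)
      finally show ?thesis by (simp add: \<phi>_def mult.assoc)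
    qed
    then have "(\<Sum>\<^sub>\<infinity>m. \<phi> (z - y + (\<chi> i. int L * m$i))) * echar ?\<theta> (rvec z)
        = (\<Sum>\<^sub>\<infinity>m. complex_of_real (f (rvec (z - y + (\<chi> i. int L * m$i)) /\<^sub>R W))) * echar ?\<theta> (rvec y)"
      by (simp add: infsum_cmult_left'[symmetric])
    also have "(\<Sum>\<^sub>\<infinity>m. complex_of_real (f (rvec (z - y + (\<chi> i. int L * m$i)) /\<^sub>R W)))
        = of_real (\<Sum>\<^sub>\<infinity>m. f (rvec (z - y + (\<chi> i. int L * m$i)) /\<^sub>R W))"
      by (intro infsumI has_sum_of_real has_sum_infsum summ)
    finally show ?thesis by (simp add: sigma2_def mult.commute)
  qed
  then have "(\<Sum>y\<in>lattice_box L. of_real (sigma2 f W L z y) * echar ?\<theta> (rvec y))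
    = echar ?\<theta> (rvec z) * (\<Sum>y\<in>lattice_box L. \<Sum>\<^sub>\<infinity>m. \<phi> (z - y + (\<chi> i. int L * m$i))) / of_real (band_norm f W)"
    by (simp add: sum_distrib_left sum_divide_distrib)
  also have "\<dots> = echar ?\<theta> (rvec z) * symb W ?\<theta>"
    unfolding sum_infsum_lattice_split[OF L \<phi>] by (simp add: symb_def \<phi>_def[abs_def])
  finally show ?thesis .
qed

lemma sum_trans_prob_echar:
  assumes W: "W > 0" and L: "L \<ge> 1" and x: "x \<in> lattice_box L"
  shows "(\<Sum>y\<in>lattice_box L. of_real (trans_prob f W L n x y) * echar (rvec k /\<^sub>R real L) (rvec y))
    = echar (rvec k /\<^sub>R real L) (rvec x) * symb W (rvec k /\<^sub>R real L) ^ n"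
proof (induction n)
  case 0
  show ?case using x by (simp add: if_distrib[of of_real] if_distrib[of "\<lambda>c. c * _"] cong: if_cong)
next
  case (Suc n)
  let ?\<theta> = "rvec k /\<^sub>R real L" and ?B = "lattice_box L"
  have "(\<Sum>y\<in>?B. of_real (trans_prob f W L (Suc n) x y) * echar ?\<theta> (rvec y))
      = (\<Sum>y\<in>?B. \<Sum>z\<in>?B. of_real (trans_prob f W L n x z) * (of_real (sigma2 f W L z y) * echar ?\<theta> (rvec y)))"
    by (simp add: sum_distrib_right mult.assoc)
  also have "\<dots> = (\<Sum>z\<in>?B. \<Sum>y\<in>?B. of_real (trans_prob f W L n x z) * (of_real (sigma2 f W L z y) * echar ?\<theta> (rvec y)))"
    by (rule sum.swap)
  also have "\<dots> = (\<Sum>z\<in>?B. of_real (trans_prob f W L n x z) * echar ?\<theta> (rvec z)) * symb W ?\<theta>"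
    by (simp add: sum_distrib_left[symmetric] sum_sigma2_echar[OF W L] sum_distrib_right mult.assoc)
  finally show ?case by (simp add: Suc mult_ac)
qed

text \<open>Insert the eigenvalue formula and exchange the sums. Two points of the box differ by
  less than \<open>L\<close> in each coordinate, so orthogonality singles out y = x.\<close>

lemma trans_prob_inversion:
  assumes W: "W > 0" and L: "L \<ge> 1" and x: "x \<in> lattice_box L"
  shows "of_real (trans_prob f W L n 0 x) * of_nat L ^ CARD('d)
    = (\<Sum>k\<in>lattice_box L. symb W (rvec k /\<^sub>R real L) ^ n * echar (rvec k /\<^sub>R real L) (rvec (- x)))"
proof -
  let ?B = "lattice_box L :: (int^'d) set" and ?p = "trans_prob f W L n 0"
  have "(\<Sum>k\<in>?B. symb W (rvec k /\<^sub>R real L) ^ n * echar (rvec k /\<^sub>R real L) (rvec (- x)))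
      = (\<Sum>k\<in>?B. (\<Sum>y\<in>?B. of_real (?p y) * echar (rvec k /\<^sub>R real L) (rvec y)) * echar (rvec k /\<^sub>R real L) (rvec (- x)))"
    by (simp add: sum_trans_prob_echar[OF W L zero_in_lattice_box[OF L]])
  also have "\<dots> = (\<Sum>k\<in>?B. \<Sum>y\<in>?B. of_real (?p y) * echar (rvec k /\<^sub>R real L) (rvec (y - x)))"
    by (simp add: sum_distrib_right mult.assoc echar_add_right[symmetric] rvec_add[symmetric])
  also have "\<dots> = (\<Sum>y\<in>?B. of_real (?p y) * (\<Sum>k\<in>?B. echar (rvec k /\<^sub>R real L) (rvec (y - x))))"
    by (subst sum.swap) (simp add: sum_distrib_left)
  also have "\<dots> = (\<Sum>y\<in>?B. of_real (?p y) * (if y = x then of_nat L ^ CARD('d) else 0))"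
  proof (rule sum.cong)
    fix y assume "y \<in> ?B"
    then have "\<bar>(y - x)$i\<bar> < int L" for i
      using x unfolding lattice_box_def by (simp add: abs_less_iff) (smt (verit))
    from sum_box_echar[OF L this] show "of_real (?p y) * (\<Sum>k\<in>?B. echar (rvec k /\<^sub>R real L) (rvec (y - x)))
        = of_real (?p y) * (if y = x then of_nat L ^ CARD('d) else 0)" by simp
  qed simp
  also have "\<dots> = of_real (?p x) * of_nat L ^ CARD('d)"
    using x by (simp add: if_distrib[of "\<lambda>c. _ * c"] cong: if_cong)
  finally show ?thesis by simp
qed

text \<open>Positive normalization makes the term at k = 0 exactly 1, which accounts for 1/N. The
  triangle inequality then removes the dependence on \<open>x\<close>.\<close>

lemma trans_prob_deviation_le:
  assumes W: "W > 0" and L: "L \<ge> 1" and x: "x \<in> lattice_box L" and M: "band_norm f W > 0"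
  shows "\<bar>trans_prob f W L n 0 x - 1 / real L ^ CARD('d)\<bar>
    \<le> (\<Sum>k\<in>lattice_box L - {0}. norm (symb W (rvec k /\<^sub>R real L)) ^ n) / real L ^ CARD('d)"
proof -
  let ?B = "lattice_box L :: (int^'d) set" and ?N = "real L ^ CARD('d)"
  let ?s = "\<lambda>k. symb W (rvec k /\<^sub>R real L) ^ n * echar (rvec k /\<^sub>R real L) (rvec (- x))"
  have N: "?N > 0" using L by simp
  have "((\<lambda>m. complex_of_real (f (rvec m /\<^sub>R W))) has_sum complex_of_real (band_norm f W)) UNIV"
    unfolding band_norm_def by (intro has_sum_of_real has_sum_infsum f_lattice_summable W)
  then have "symb W 0 = 1" using M by (simp add: symb_def infsumI)
  then have "?s 0 = 1" by simp
  moreover have "(\<Sum>k\<in>?B. ?s k) = ?s 0 + (\<Sum>k\<in>?B - {0}. ?s k)"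
    using zero_in_lattice_box[OF L] by (intro sum.remove) auto
  ultimately have "of_real (trans_prob f W L n 0 x * ?N - 1) = (\<Sum>k\<in>?B - {0}. ?s k)"
    using trans_prob_inversion[OF W L x, of n] by simp
  then have "\<bar>trans_prob f W L n 0 x * ?N - 1\<bar> = norm (\<Sum>k\<in>?B - {0}. ?s k)"
    by (metis norm_of_real)
  also have "\<dots> \<le> (\<Sum>k\<in>?B - {0}. norm (symb W (rvec k /\<^sub>R real L)) ^ n)"
    by (rule sum_norm_le) (simp add: norm_mult norm_power)
  finally have "\<bar>trans_prob f W L n 0 x * ?N - 1\<bar> / ?N \<le> (\<Sum>k\<in>?B - {0}. norm (symb W (rvec k /\<^sub>R real L)) ^ n) / ?N"
    by (rule divide_right_mono) simp
  moreover have "\<bar>trans_prob f W L n 0 x - 1 / ?N\<bar> = \<bar>trans_prob f W L n 0 x * ?N - 1\<bar> / ?N"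
  proof -
    have "trans_prob f W L n 0 x - 1 / ?N = (trans_prob f W L n 0 x * ?N - 1) / ?N"
      using N by (simp add: field_simps)
    then show ?thesis using N by (simp only: abs_divide abs_of_pos)
  qed
  ultimately show ?thesis by simp
qed

section \<open>Averages over nonzero frequencies\<close>

text \<open>The symbol is periodic in the frequency but its approximation holds on the centred cube
  only, so each coordinate above L/2 is lowered by \<open>L\<close>. Reduction modulo
  \<open>L\<close> undoes this, hence no frequency is merged with another or with 0.\<close>

lemma centered_representatives:
  assumes L: "L \<ge> 1"
  shows "\<exists>J::(int^'d) set. finite J \<and> 0 \<notin> J \<and> card J \<le> L ^ CARD('d) \<and>
     (\<forall>j\<in>J. rvec j /\<^sub>R real L \<in> centered_cube) \<and>
     (\<forall>W h. (\<Sum>k\<in>lattice_box L - {0}. h (symb W (rvec k /\<^sub>R real L)))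
            = (\<Sum>j\<in>J. h (symb W (rvec j /\<^sub>R real L)) :: real))"
proof -
  define e :: "int^'d \<Rightarrow> int^'d" where "e k = (\<chi> i. if 2 * k$i \<le> int L then 0 else - 1)" for k
  define c where "c k = k + (\<chi> i. int L * e k $ i)" for k
  let ?B = "lattice_box L - {0::int^'d}"
  have c_mod: "c k $ i mod int L = k $ i" if "k \<in> lattice_box L" for k i
    using that by (auto simp: c_def lattice_box_def)
  have inj: "inj_on c ?B"
    by (rule inj_onI) (metis DiffD1 c_mod vec_eq_iff)
  have c0: "c k \<noteq> 0" if "k \<in> ?B" for k
  proof
    assume "c k = 0"
    then have "k $ i = 0" for i using c_mod[of k i] that by simp
    then show False using that by (auto simp: vec_eq_iff)
  qed
  have "0 \<notin> c ` ?B" using c0 by (metis imageE)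
  moreover have "rvec (c k) /\<^sub>R real L \<in> centered_cube" if "k \<in> ?B" for k
    unfolding mem_centered_cube
  proof
    fix i
    have "0 \<le> k$i" "k$i < int L" using that by (auto simp: lattice_box_def)
    then have "2 * \<bar>c k $ i\<bar> \<le> int L" by (auto simp: c_def e_def)
    then have "2 * \<bar>real_of_int (c k $ i)\<bar> \<le> real L" by linarith
    then show "\<bar>(rvec (c k) /\<^sub>R real L) $ i\<bar> \<le> 1/2" using L by (simp add: abs_mult field_simps)
  qed
  moreover have "symb W (rvec (c k) /\<^sub>R real L) = symb W (rvec k /\<^sub>R real L)" for W k
  proof -
    have "rvec (c k) /\<^sub>R real L = rvec k /\<^sub>R real L + rvec (e k)"
      using L by (simp add: c_def vec_eq_iff field_simps)
    then show ?thesis by (simp add: symb_periodic)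
  qed
  \<comment> \<open>Orthogonality at z = 0 counts the box.\<close>
  moreover have "card (lattice_box L :: (int^'d) set) = L ^ CARD('d)"
  proof -
    have "complex_of_nat (card (lattice_box L :: (int^'d) set)) = of_nat (L ^ CARD('d))"
      using sum_box_echar[OF L, of "0 :: int^'d"] L by simp
    then show ?thesis by (simp only: of_nat_eq_iff)
  qed
  then have "card (c ` ?B) \<le> L ^ CARD('d)"
    by (metis card_Diff1_le card_image inj finite_lattice_box le_trans)
  ultimately show ?thesis
    by (intro exI[of _ "c ` ?B"]) (auto simp: sum.reindex[OF inj])
qed

lemma fourier_power_sum_bound:
  fixes \<alpha> c0 \<epsilon> \<rho> :: real
  assumes \<alpha>: "\<alpha> > 0" and c0: "c0 > 0" and \<rho>: "0 < \<rho>" "\<rho> < 1"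
    and near: "\<And>\<xi>. norm \<xi> \<le> \<epsilon> \<Longrightarrow> norm (fourier f \<xi>) \<le> exp (- c0 * norm \<xi> powr \<alpha>)"
    and far: "\<And>\<xi>. norm \<xi> > \<epsilon> \<Longrightarrow> norm (fourier f \<xi>) \<le> \<rho>"
  shows "\<exists>C>0. \<forall>(L::nat) (W::real) (n::nat) J. L \<ge> 1 \<longrightarrow> W > 0 \<longrightarrow> n \<ge> 1 \<longrightarrow> finite J \<longrightarrow> 0 \<notin> J \<longrightarrow>
    (\<Sum>j\<in>J. norm (fourier f (W *\<^sub>R (rvec j /\<^sub>R real L))) ^ n) / real L ^ CARD('d)
      \<le> C * W powr (- real CARD('d)) * real n powr (- real CARD('d) / \<alpha>)"
proof -
  let ?d = "real CARD('d)"
  obtain Z where Z: "Z > 0" "\<And>a A. a > 0 \<Longrightarrow> finite A \<Longrightarrow> (0::int^'d) \<notin> A \<Longrightarrow>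
      (\<Sum>k\<in>A. (1 + a * norm (rvec k)) powr (- K)) \<le> Z * a powr (- ?d)"
    using sum_lattice_powr_le[OF K] by blast
  obtain C1 where C1: "C1 > 0" "\<And>t. t \<ge> 0 \<Longrightarrow> exp (- c0 * t powr \<alpha>) \<le> C1 * (1 + t) powr (- K)"
    using exp_powr_decay[OF c0 K_pos \<alpha>] by blast
  obtain C2 where C2: "C2 > 0" "\<And>n. n \<ge> 1 \<Longrightarrow> \<rho> ^ (n - 1) \<le> C2 * real n powr (- (?d / \<alpha>))"
    using power_le_powr_decay[OF \<rho>, of "?d / \<alpha>"] \<alpha> by auto
  define C where "C = C1 * Z + C2 * CK * Z"
  have C: "C > 0" using C1 C2 Z CK by (simp add: C_def add_pos_pos)
  have "(\<Sum>j\<in>J. norm (fourier f (W *\<^sub>R (rvec j /\<^sub>R real L))) ^ n) / real L ^ CARD('d)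
      \<le> C * W powr (- ?d) * real n powr (- ?d / \<alpha>)"
    if L: "L \<ge> 1" and W: "W > 0" and n: "n \<ge> 1" and J: "finite J" "0 \<notin> J" for L n :: nat and W J
  proof -
    define a where "a = W / real L"
    \<comment> \<open>The scale satisfies n |\<xi>|^\<alpha> = (b |j|)^\<alpha>, so b^-d carries the
      factor n^(-d/\<alpha>) at low frequencies. At high frequencies the scale stays
      \<open>a\<close> and \<open>s\<close> supplies that factor.\<close>
    define b where "b = real n powr (1 / \<alpha>) * a"
    define s where "s = real n powr (- (?d / \<alpha>))"
    have a: "a > 0" using L W by (simp add: a_def)
    have b: "b > 0" using a n by (simp add: b_def)
    \<comment> \<open>Adding the bounds of both regimes for every \<open>j\<close> avoids splitting
      \<open>J\<close>.\<close>
    have bound_j: "norm (fourier f (W *\<^sub>R (rvec j /\<^sub>R real L))) ^ n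
        \<le> C1 * (1 + b * norm (rvec j)) powr (- K) + C2 * CK * s * (1 + a * norm (rvec j)) powr (- K)" for j :: "int^'d"
    proof -
      define \<xi> where "\<xi> = W *\<^sub>R (rvec j /\<^sub>R real L)"
      have norm_\<xi>: "norm \<xi> = a * norm (rvec j)" using W L by (simp add: \<xi>_def a_def divide_inverse)
      show ?thesis
      proof (cases "norm \<xi> \<le> \<epsilon>")
        case True
        have "norm (fourier f \<xi>) ^ n \<le> exp (- c0 * norm \<xi> powr \<alpha>) ^ n"
          using near[OF True] by (intro power_mono) auto
        also have "\<dots> = exp (- c0 * (real n * norm \<xi> powr \<alpha>))"
          by (simp add: exp_of_nat_mult[symmetric] mult_ac)
        also have "real n * norm \<xi> powr \<alpha> = (b * norm (rvec j)) powr \<alpha>"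
          using \<alpha> by (simp add: norm_\<xi> b_def powr_mult powr_powr mult_ac)
        also have "exp (- c0 * (b * norm (rvec j)) powr \<alpha>) \<le> C1 * (1 + b * norm (rvec j)) powr (- K)"
          using b by (intro C1) auto
        finally show ?thesis using C2 CK by (simp add: \<xi>_def s_def add_increasing2)
      next
        case False
        have "norm (fourier f \<xi>) ^ n = norm (fourier f \<xi>) ^ (n - 1) * norm (fourier f \<xi>)"
          using n by (cases n) auto
        also have "\<dots> \<le> \<rho> ^ (n - 1) * (CK * (1 + norm \<xi>) powr (- K))"
          using far[of \<xi>] False \<rho> decay_fourier[of \<xi>] by (intro mult_mono power_mono) auto
        also have "\<dots> \<le> (C2 * s) * (CK * (1 + norm \<xi>) powr (- K))"
          unfolding s_def using C2(2)[OF n] CK by (intro mult_right_mono) auto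
        finally have "norm (fourier f \<xi>) ^ n \<le> C2 * CK * s * (1 + a * norm (rvec j)) powr (- K)"
          by (simp add: norm_\<xi> mult_ac)
        then show ?thesis using C1 by (simp add: \<xi>_def add_increasing)
      qed
    qed
    have a_powr: "a powr (- ?d) = W powr (- ?d) * real L ^ CARD('d)"
      unfolding a_def powr_divide using L W by (simp add: powr_minus powr_realpow divide_inverse)
    have b_powr: "b powr (- ?d) = s * a powr (- ?d)"
      by (simp add: b_def s_def powr_mult powr_powr)
    have "(\<Sum>j\<in>J. norm (fourier f (W *\<^sub>R (rvec j /\<^sub>R real L))) ^ n)
        \<le> (\<Sum>j\<in>J. C1 * (1 + b * norm (rvec j)) powr (- K) + C2 * CK * s * (1 + a * norm (rvec j)) powr (- K))"
      by (rule sum_mono) (rule bound_j)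
    also have "\<dots> = C1 * (\<Sum>j\<in>J. (1 + b * norm (rvec j)) powr (- K)) + C2 * CK * s * (\<Sum>j\<in>J. (1 + a * norm (rvec j)) powr (- K))"
      by (simp add: sum.distrib sum_distrib_left)
    also have "\<dots> \<le> C1 * (Z * b powr (- ?d)) + C2 * CK * s * (Z * a powr (- ?d))"
      using C1 C2 CK by (intro add_mono mult_left_mono Z(2) a b J) (auto simp: s_def)
    also have "\<dots> = C * W powr (- ?d) * s * real L ^ CARD('d)"
      by (simp add: b_powr a_powr C_def algebra_simps)
    finally show ?thesis using L by (simp add: s_def pos_divide_le_eq)
  qed
  with C show ?thesis by blast
qed

section \<open>The local limit estimate\<close>

theorem trans_prob_local_limit:
  fixes \<alpha> c0 \<epsilon> \<rho> :: real
  assumes "\<alpha> > 0" "c0 > 0" "0 < \<rho>" "\<rho> < 1"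
    and "\<And>\<xi>. norm \<xi> \<le> \<epsilon> \<Longrightarrow> norm (fourier f \<xi>) \<le> exp (- c0 * norm \<xi> powr \<alpha>)"
    and "\<And>\<xi>. norm \<xi> > \<epsilon> \<Longrightarrow> norm (fourier f \<xi>) \<le> \<rho>"
  shows "\<exists>C>0. \<exists>C'>0. \<forall>(L::nat) (W::real) (n::nat) x. L \<ge> 1 \<longrightarrow> W > 0 \<longrightarrow> n \<ge> 1 \<longrightarrow> x \<in> lattice_box L \<longrightarrow>
    \<bar>trans_prob f W L n 0 x - 1 / real L ^ CARD('d)\<bar>
      \<le> C * W powr (- real CARD('d)) * real n powr (- real CARD('d) / \<alpha>) + C' * real n * W powr (- K)"
proof -
  obtain D W0 where D: "D > 0" "W0 > 0" "\<And>W. W \<ge> W0 \<Longrightarrow> band_norm f W > 0"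
    "\<And>W \<theta>. W \<ge> W0 \<Longrightarrow> \<theta> \<in> centered_cube \<Longrightarrow> norm (symb W \<theta> - fourier f (W *\<^sub>R \<theta>)) \<le> D * W powr (- K)"
    using symb_approx by blast
  obtain C where C: "C > 0" "\<And>(L::nat) (W::real) (n::nat) J. L \<ge> 1 \<Longrightarrow> W > 0 \<Longrightarrow> n \<ge> 1 \<Longrightarrow> finite J \<Longrightarrow> 0 \<notin> J \<Longrightarrow>
    (\<Sum>j\<in>J. norm (fourier f (W *\<^sub>R (rvec j /\<^sub>R real L))) ^ n) / real L ^ CARD('d)
      \<le> C * W powr (- real CARD('d)) * real n powr (- real CARD('d) / \<alpha>)"
    using fourier_power_sum_bound[OF assms] by blast
  \<comment> \<open>\<open>D\<close> is the approximation error for large \<open>W\<close>;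
    \<open>W0 powr K\<close> makes the error term at least 1 when W < W0.\<close>
  define C' where "C' = D + W0 powr K"
  have C': "C' > 0" using D by (simp add: C'_def add_pos_nonneg)
  have "\<bar>trans_prob f W L n 0 x - 1 / real L ^ CARD('d)\<bar>
      \<le> C * W powr (- real CARD('d)) * real n powr (- real CARD('d) / \<alpha>) + C' * real n * W powr (- K)"
    if L: "L \<ge> 1" and W: "W > 0" and n: "n \<ge> 1" and x: "x \<in> lattice_box L" for L n :: nat and W x
  proof (cases "W \<ge> W0")
    case False
    have N: "real L ^ CARD('d) \<ge> 1" using L by simp
    then have "0 \<le> 1 / real L ^ CARD('d)" "1 / real L ^ CARD('d) \<le> 1" using L by (simp_all add: divide_le_eq_1)
    then have "\<bar>trans_prob f W L n 0 x - 1 / real L ^ CARD('d)\<bar> \<le> 1"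
      using trans_prob_nonneg[of W L n 0 x] trans_prob_le_1[OF W L x, of n 0] by linarith
    also have "1 = W0 powr K * 1 * W0 powr (- K)" using D by (simp add: powr_minus)
    also have "\<dots> \<le> C' * real n * W powr (- K)"
      using False W D n K_pos by (intro mult_mono powr_mono2') (auto simp: C'_def)
    also have "\<dots> \<le> C * W powr (- real CARD('d)) * real n powr (- real CARD('d) / \<alpha>) + C' * real n * W powr (- K)"
      using C by simp
    finally show ?thesis .
  next
    case True
    let ?N = "real L ^ CARD('d)" and ?h = "\<lambda>j. fourier f (W *\<^sub>R (rvec j /\<^sub>R real L))"
    have N: "?N > 0" using L by simp
    obtain J :: "(int^'d) set" where J: "finite J" "0 \<notin> J" "card J \<le> L ^ CARD('d)"
      "\<And>j. j \<in> J \<Longrightarrow> rvec j /\<^sub>R real L \<in> centered_cube"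
      "\<And>W h. (\<Sum>k\<in>lattice_box L - {0}. h (symb W (rvec k /\<^sub>R real L))) = (\<Sum>j\<in>J. h (symb W (rvec j /\<^sub>R real L)) :: real)"
      using centered_representatives[OF L] by blast
    have bound_j: "norm (symb W (rvec j /\<^sub>R real L)) ^ n \<le> norm (?h j) ^ n + real n * (D * W powr (- K))" if "j \<in> J" for j
    proof -
      let ?s = "symb W (rvec j /\<^sub>R real L)"
      have "norm (?s ^ n) - norm (?h j ^ n) \<le> norm (?s ^ n - ?h j ^ n)" by (rule norm_triangle_ineq2)
      also have "\<dots> \<le> real n * norm (?s - ?h j)"
        by (rule norm_power_diff[OF norm_symb_le_1[OF W] norm_fourier_le_1])
      also have "\<dots> \<le> real n * (D * W powr (- K))"
        by (intro mult_left_mono D(4)[OF True] J(4) that) auto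
      finally show ?thesis by (simp add: norm_power)
    qed
    have "\<bar>trans_prob f W L n 0 x - 1 / ?N\<bar> \<le> (\<Sum>k\<in>lattice_box L - {0}. norm (symb W (rvec k /\<^sub>R real L)) ^ n) / ?N"
      by (rule trans_prob_deviation_le[OF W L x D(3)[OF True]])
    also have "\<dots> = (\<Sum>j\<in>J. norm (symb W (rvec j /\<^sub>R real L)) ^ n) / ?N"
      using J(5)[of "\<lambda>z. norm z ^ n" W] by simp
    also have "\<dots> \<le> (\<Sum>j\<in>J. norm (?h j) ^ n + real n * (D * W powr (- K))) / ?N"
      using N by (intro divide_right_mono sum_mono bound_j) auto
    \<comment> \<open>The replacement error is averaged over at most N frequencies, so it picks up
      no power of \<open>L\<close>.\<close>
    also have "\<dots> = (\<Sum>j\<in>J. norm (?h j) ^ n) / ?N + (real (card J) / ?N) * (D * real n * W powr (- K))"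
      by (simp add: sum.distrib add_divide_distrib mult_ac)
    also have "\<dots> \<le> C * W powr (- real CARD('d)) * real n powr (- real CARD('d) / \<alpha>) + 1 * (C' * real n * W powr (- K))"
    proof (intro add_mono mult_mono C(2) L W n J(1,2))
      have "real (card J) \<le> real (L ^ CARD('d))" using J(3) by (simp only: of_nat_le_iff)
      then show "real (card J) / ?N \<le> 1" using N by (simp add: pos_divide_le_eq)
    qed (use D C' in \<open>auto simp: C'_def\<close>)
    finally show ?thesis by simp
  qed
  with C(1) C' show ?thesis by blast
qed

end

text \<open>The relation nW^-K << N^-1 is rendered as \<open><=\<close> with constant 1. Under it
  the error term of the first estimate is at most C'/N, which yields the second.\<close>

theorem theoremD1:
  fixes f :: "real^'d \<Rightarrow> real" and \<alpha> K :: real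
  assumes alpha: "0 < \<alpha>" "\<alpha> \<le> 2"
    and nonneg: "\<forall>u. 0 \<le> f u"
    and int1: "(f has_integral 1) UNIV"
    and four: "\<exists>c0 \<epsilon> \<rho>. c0 > 0 \<and> \<epsilon> > 0 \<and> 0 < \<rho> \<and> \<rho> < 1 \<and>
                 (\<forall>\<xi>. norm \<xi> \<le> \<epsilon> \<longrightarrow> cmod (fourier f \<xi>) \<le> exp (- c0 * norm \<xi> powr \<alpha>)) \<and>
                 (\<forall>\<xi>. norm \<xi> > \<epsilon> \<longrightarrow> cmod (fourier f \<xi>) \<le> \<rho>)"
    and cont: "continuous_on UNIV f"
    and Kd: "K > real CARD('d)"
    and decayf: "\<exists>T CT. T > real CARD('d) \<and> CT > 1 \<and> (\<forall>u. f u \<le> CT * (1 + norm u) powr (- T))"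
    and decayF: "\<exists>CK > 1. \<forall>\<xi>. cmod (fourier f \<xi>) \<le> CK * (1 + norm \<xi>) powr (- K)"
  shows "\<exists>C > 0. \<exists>C' > 0. \<forall>(L::nat) (W::real) (n::nat) x.
           L \<ge> 1 \<longrightarrow> W > 0 \<longrightarrow> n \<ge> 1 \<longrightarrow> x \<in> lattice_box L \<longrightarrow>
           (\<bar>trans_prob f W L n 0 x - 1 / real L ^ CARD('d)\<bar>
               \<le> C * W powr (- real CARD('d)) * real n powr (- real CARD('d) / \<alpha>)
                 + C' * real n * W powr (- K))
           \<and> (real n * W powr (- K) \<le> 1 / real L ^ CARD('d) \<longrightarrow>
               trans_prob f W L n 0 x
                 \<le> C * (W powr (- real CARD('d)) * real n powr (- real CARD('d) / \<alpha>)
                        + 1 / real L ^ CARD('d)))"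
proof -
  obtain T CT CK where "T > real CARD('d)" "CT > 1" "\<And>u. f u \<le> CT * (1 + norm u) powr (- T)"
    "CK > 1" "\<And>\<xi>. cmod (fourier f \<xi>) \<le> CK * (1 + norm \<xi>) powr (- K)"
    using decayf decayF by blast
  then interpret band_profile f T CT K CK
    using nonneg int1 cont Kd by unfold_locales auto
  obtain c0 \<epsilon> \<rho> where hyp: "c0 > 0" "0 < \<rho>" "\<rho> < 1"
    "\<And>\<xi>. norm \<xi> \<le> \<epsilon> \<Longrightarrow> norm (fourier f \<xi>) \<le> exp (- c0 * norm \<xi> powr \<alpha>)"
    "\<And>\<xi>. norm \<xi> > \<epsilon> \<Longrightarrow> norm (fourier f \<xi>) \<le> \<rho>"
    using four by blast
  obtain C C' where C: "C > 0" "C' > 0"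
    and dev: "\<And>(L::nat) (W::real) (n::nat) x. L \<ge> 1 \<Longrightarrow> W > 0 \<Longrightarrow> n \<ge> 1 \<Longrightarrow> x \<in> lattice_box L \<Longrightarrow>
    \<bar>trans_prob f W L n 0 x - 1 / real L ^ CARD('d)\<bar>
      \<le> C * W powr (- real CARD('d)) * real n powr (- real CARD('d) / \<alpha>) + C' * real n * W powr (- K)"
    using trans_prob_local_limit[OF alpha(1) hyp] by blast
  \<comment> \<open>One constant serves both estimates: it dominates \<open>C\<close> in front of
    W^-d n^(-d/\<alpha>) and 1 + \<open>C'\<close> in front of 1/N.\<close>
  show ?thesis
  proof (rule exI[of _ "C + C' + 1"], rule conjI[rotated], rule exI[of _ C'], intro conjI allI impI)
    fix L n :: nat and W :: real and x :: "int^'d"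
    assume prems: "L \<ge> 1" "W > 0" "n \<ge> 1" "x \<in> lattice_box L"
    let ?w = "W powr (- real CARD('d)) * real n powr (- real CARD('d) / \<alpha>)" and ?v = "1 / real L ^ CARD('d)"
    have le: "C * ?w \<le> (C + C' + 1) * ?w" using C by (intro mult_right_mono) auto
    then show "\<bar>trans_prob f W L n 0 x - ?v\<bar> \<le> (C + C' + 1) * W powr (- real CARD('d)) * real n powr (- real CARD('d) / \<alpha>)
        + C' * real n * W powr (- K)"
      using dev[OF prems] by (simp only: mult.assoc)
    assume "real n * W powr (- K) \<le> ?v"
    then have "C' * (real n * W powr (- K)) \<le> C' * ?v" using C by (intro mult_left_mono) auto
    moreover have "(1 + C') * ?v \<le> (C + C' + 1) * ?v" using C by (intro mult_right_mono) auto
    then have "?v + C' * ?v \<le> (C + C' + 1) * ?v" by (simp only: distrib_right mult_1)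
    ultimately show "trans_prob f W L n 0 x \<le> (C + C' + 1) * (?w + ?v)"
      using dev[OF prems] le unfolding distrib_left[of "C + C' + 1"] by (simp only: mult.assoc)
  qed (use C in auto)
qed

end
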